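(* Let $x$ and $y$ be non-similar skew Sturmian sequences in $\{0,1\}^{\mathbb Z}$, and let $X$ and $Y$ be the subshifts generated by $x$ and $y$ respectively. Then $X$ and $Y$ are conjugate if and only if $x$ and $y$ have inverse frequencies and are of opposite type (one is of type $S$ and the other is of type $S'$). Here the frequencies $0$ and $\infty$ are considered inverse to each other.
   Context: The alphabet is $\mathcal A=\{0,1\}$; $\mathcal A^{\mathbb Z}$ is the space of bi-infinite sequences with the product topology and the shift is $\sigma(x)_i=x_{i+1}$. Sequences $x,y$ are similar if $\sigma^k(x)=y$ for some $k\in\mathbb Z$. A sequence is periodic if $\sigma^N(x)=x$ for some $N>0$. The subshift generated by $x$ is the closure of $\{\sigma^k(x):k\in\mathbb Z\}$. Two subshifts are conjugate if there is a bijective sliding block code from one to the other (equivalently, a homeomorphism commuting with the shift maps). Cell-series: a sequence $x$ is written as a bi-infinite concatenation $\cdots B_{-1}B_0B_1\cdots$ where each cell $B_i$ is a word consisting of the symbol $1$ followed by a (possibly empty) string of $0$'s. An $n$-chain is a word of the form $B_r\cdots B_s$ with $n=s-r+1\geq 1$. The sequence $x$ is Sturmian if for every $m>0$ the numbers of $0$'s in any two $m$-chains of $x$ differ by at most one. If $b_n$ denotes the number of $0$'s in an $n$-chain, the limit $\lim_{n\to\infty} b_n/n$ exists and is called the frequency of $x$. A skew Sturmian sequence is a non-periodic Sturmian sequence with rational frequency. A cell-series determines a sequence up to similarity. Types: let $\alpha=q/p$ with $p,q$ relatively prime positive integers, $\beta=1/\alpha=p/q$, $m\in\mathbb Z$,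 $G=\{m+k\beta:k\in\mathbb Z\}$. The cell-series $S(m,\alpha)$ is the one in which the number of $0$'s in $B_n$ is the number of points $z\in G$ with $n<z\le n+1$ if $n<m$, with $m<z<m+1$ if $n=m$, and with $n\le z<n+1$ if $n>m$. The cell-series $S'(m,\alpha)$ is the one in which the number of $0$'s in $B_n$ is the number of points $z\in G$ with $n\le z<n+1$ if $n<m$, with $m\le z\le m+1$ if $n=m$, and with $n<z\le n+1$ if $n>m$. These are skew Sturmian of frequency $\alpha$ and, up to similarity, do not depend on $m$. A skew Sturmian sequence is of type $S$ (respectively $S'$) if it has cell-series representation $S(m,\alpha)$ (respectively $S'(m,\alpha)$) for some $m\in\mathbb Z$. By convention, the sequence $\cdots1110111\cdots$ is $S'(m,0)$ (type $S'$, frequency $0$), and the sequence $\cdots0001000\cdots$ is denoted $S(m,\infty)$ and is also counted as a skew Sturmian sequence (type $S$, frequency $\infty$); $S(m,0)$ and $S'(m,\infty)$ are not defined. By a theorem of Morse and Hedlund (taken as known), every skew Sturmian sequence of positive frequency $\alpha$ is of type $S$ or $S'$; those of frequency $0$ and $\infty$ are, up to similarity, only $S'(m,0)$ and $S(m,\infty)$ respectively. *)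

theory Defs
  imports "HOL-Analysis.Analysis"
begin

text \<open>
  The symbol 1 is represented by \<^term>\<open>True\<close> and the symbol 0 by \<^term>\<open>False\<close>. The order topology
  on \<^typ>\<open>bool\<close> is the discrete one, so the library topology on \<^typ>\<open>int \<Rightarrow> bool\<close> is the usual
  product topology on the space of bi-infinite binary sequences.
\<close>

type_synonym biseq = "int \<Rightarrow> bool"


text \<open>\<open>shift k\<close> is the \<open>k\<close>-th iterate of the shift map \<open>shift 1\<close>, for any integer \<open>k\<close>.\<close>

definition shift :: "int \<Rightarrow> biseq \<Rightarrow> biseq" where
  "shift k x = (\<lambda>i. x (i + k))"

definition similar :: "biseq \<Rightarrow> biseq \<Rightarrow> bool" where
  "similar x y \<longleftrightarrow> (\<exists>k. shift k x = y)"

definition periodic_seq :: "biseq \<Rightarrow> bool" where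
  "periodic_seq x \<longleftrightarrow> (\<exists>N>0. shift N x = x)"

definition generated_subshift :: "biseq \<Rightarrow> biseq set" where
  "generated_subshift x = closure (range (\<lambda>k. shift k x))"

definition block :: "biseq \<Rightarrow> int \<Rightarrow> int \<Rightarrow> bool list" where
  "block x i j = map x [i..j]"

definition sliding_block_code :: "biseq set \<Rightarrow> biseq set \<Rightarrow> (biseq \<Rightarrow> biseq) \<Rightarrow> bool" where
  "sliding_block_code X Y f \<longleftrightarrow>
     f ` X \<subseteq> Y \<and>
     (\<exists>(a::nat) (b::nat) (\<Phi> :: bool list \<Rightarrow> bool).
        \<forall>x\<in>X. \<forall>i. f x i = \<Phi> (block x (i - int a) (i + int b)))"

definition conjugate :: "biseq set \<Rightarrow> biseq set \<Rightarrow> bool" where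
  "conjugate X Y \<longleftrightarrow> (\<exists>f. sliding_block_code X Y f \<and> bij_betw f X Y)"


text \<open>
  A cell-series is encoded by the numbers \<open>c n\<close> of 0's in its cells \<open>B\<^sub>n\<close>. In
  \<open>has_cell_series\<close>, \<open>t n\<close> is the position at which \<open>B\<^sub>n\<close> starts; as cells are nonempty,
  the cells exhaust the whole of the sequence.
\<close>

definition cell :: "nat \<Rightarrow> bool list" where
  "cell k = True # replicate k False"

definition has_cell_series :: "biseq \<Rightarrow> (int \<Rightarrow> nat) \<Rightarrow> bool" where
  "has_cell_series x c \<longleftrightarrow>
     (\<exists>t :: int \<Rightarrow> int. \<forall>n. t (n + 1) = t n + int (length (cell (c n))) \<and>
                            block x (t n) (t (n + 1) - 1) = cell (c n))"

definition chain :: "(int \<Rightarrow> nat) \<Rightarrow> int \<Rightarrow> int \<Rightarrow> bool list" where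
  "chain c r s = concat (map (\<lambda>i. cell (c i)) [r..s])"

definition zeros :: "bool list \<Rightarrow> nat" where
  "zeros w = count_list w False"

text \<open>The \<open>m\<close>-chains are the words \<open>chain c r (r + int m - 1)\<close>.\<close>

definition sturmian :: "biseq \<Rightarrow> bool" where
  "sturmian x \<longleftrightarrow>
     (\<exists>c. has_cell_series x c \<and>
        (\<forall>m>0. \<forall>r s. \<bar>int (zeros (chain c r (r + int m - 1))) -
                        int (zeros (chain c s (s + int m - 1)))\<bar> \<le> 1))"

text \<open>The \<open>n\<close>-chain whose zeros are counted may be chosen arbitrarily for each \<open>n\<close>.\<close>

definition has_finite_frequency :: "biseq \<Rightarrow> real \<Rightarrow> bool" where
  "has_finite_frequency x \<alpha> \<longleftrightarrow>
     (\<exists>c. has_cell_series x c \<and>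
        (\<forall>r :: nat \<Rightarrow> int.
           (\<lambda>n. real (zeros (chain c (r n) (r n + int n - 1))) / real n) \<longlonglongrightarrow> \<alpha>))"


text \<open>
  The two sequences \<open>\<dots>0001000\<dots>\<close> and \<open>\<dots>1110111\<dots>\<close> (up to similarity). The former is not a
  bi-infinite concatenation of cells; it is a skew Sturmian sequence by convention.
\<close>

definition single_one :: "biseq \<Rightarrow> bool" where
  "single_one x \<longleftrightarrow> (\<exists>k. \<forall>i. x i \<longleftrightarrow> i = k)"

definition single_zero :: "biseq \<Rightarrow> bool" where
  "single_zero x \<longleftrightarrow> (\<exists>k. \<forall>i. x i \<longleftrightarrow> i \<noteq> k)"

definition skew_sturmian :: "biseq \<Rightarrow> bool" where
  "skew_sturmian x \<longleftrightarrow>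
     (sturmian x \<and> \<not> periodic_seq x \<and> (\<exists>\<alpha>\<in>\<rat>. has_finite_frequency x \<alpha>)) \<or> single_one x"

definition has_frequency :: "biseq \<Rightarrow> ereal \<Rightarrow> bool" where
  "has_frequency x a \<longleftrightarrow>
     (\<exists>\<alpha>. a = ereal \<alpha> \<and> has_finite_frequency x \<alpha>) \<or> (a = \<infinity> \<and> single_one x)"

definition inverse_frequencies :: "biseq \<Rightarrow> biseq \<Rightarrow> bool" where
  "inverse_frequencies x y \<longleftrightarrow> (\<exists>a. has_frequency x a \<and> has_frequency y (inverse a))"

text \<open>On the extended reals, \<open>0\<close> and \<open>\<infinity>\<close> are mutually inverse.\<close>

lemma "inverse (0::ereal) = \<infinity>" "inverse (\<infinity>::ereal) = 0"
  by simp_all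


definition grid :: "int \<Rightarrow> real \<Rightarrow> real set" where
  "grid m \<beta> = {real_of_int m + real_of_int k * \<beta> | k. True}"

definition S_cells :: "int \<Rightarrow> real \<Rightarrow> int \<Rightarrow> nat" where
  "S_cells m \<alpha> n = card {z \<in> grid m (1 / \<alpha>).
     if n < m then real_of_int n < z \<and> z \<le> real_of_int n + 1
     else if n = m then real_of_int m < z \<and> z < real_of_int m + 1
     else real_of_int n \<le> z \<and> z < real_of_int n + 1}"

definition S'_cells :: "int \<Rightarrow> real \<Rightarrow> int \<Rightarrow> nat" where
  "S'_cells m \<alpha> n = card {z \<in> grid m (1 / \<alpha>).
     if n < m then real_of_int n \<le> z \<and> z < real_of_int n + 1
     else if n = m then real_of_int m \<le> z \<and> z \<le> real_of_int m + 1
     else real_of_int n < z \<and> z \<le> real_of_int n + 1}"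

text \<open>
  The frequencies \<open>0\<close> and \<open>\<infinity>\<close> are covered by the conventions that \<open>\<dots>0001000\<dots>\<close> has type \<open>S\<close>
  and \<open>\<dots>1110111\<dots>\<close> has type \<open>S'\<close>.
\<close>

definition type_S :: "biseq \<Rightarrow> bool" where
  "type_S x \<longleftrightarrow>
     (\<exists>(p::nat) (q::nat) m. 0 < p \<and> 0 < q \<and> coprime q p \<and>
        has_cell_series x (S_cells m (real q / real p))) \<or> single_one x"

definition type_S' :: "biseq \<Rightarrow> bool" where
  "type_S' x \<longleftrightarrow>
     (\<exists>(p::nat) (q::nat) m. 0 < p \<and> 0 < q \<and> coprime q p \<and>
        has_cell_series x (S'_cells m (real q / real p))) \<or> single_zero x"

definition opposite_type :: "biseq \<Rightarrow> biseq \<Rightarrow> bool" where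
  "opposite_type x y \<longleftrightarrow> (type_S x \<and> type_S' y) \<or> (type_S' x \<and> type_S y)"

end

theory Submission
  imports Defs
begin

text \<open>
  A skew Sturmian sequence follows a periodic sequence \<open>u\<close> of least period \<open>N\<close> on the left and its
  translate by some \<open>k\<close> on the right. A conjugacy preserves \<open>N\<close> and the residue of \<open>k\<close> modulo \<open>N\<close>.
  If \<open>u\<close> has \<open>p\<close> symbols 1 per period, then the frequency is \<open>(N - p) / p\<close> and \<open>k * p\<close> is \<open>1\<close> modulo
  \<open>N\<close> for type \<open>S\<close> and \<open>-1\<close> for type \<open>S'\<close>. Hence for equal types \<open>p\<close> is a conjugacy invariant,
  whereas for opposite types conjugacy forces \<open>p\<close> and \<open>N - p\<close>. Conversely, exchanging the symbols
  0 and 1 is a conjugacy that swaps the types and inverts the frequency.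
\<close>


subsection \<open>Limits of shifts and the asymptotic phase\<close>

text \<open>Cell-series do not suit the argument: a single 1 among 0's has none, and exchanging the
  symbols destroys the cells. The proof therefore works with binary words given by residues modulo
  \<open>N\<close>, in which the frequencies 0 and \<infinity> are the ordinary parameters
  \<open>p = N\<close> and \<open>p = 0\<close>. A conjugacy could a priori send \<open>x\<close> to
  any point of the other subshift. It is pinned down because the only nonperiodic points there are
  the shifts of \<open>y\<close>. So one and the same code carries both ends of \<open>x\<close> to
  the two ends of a shift of \<open>y\<close>, and since it commutes with the shift, the
  displacement between the ends survives. Non-similarity enters at one place only: for equal types
  the invariants make the two words equal, which would make \<open>x\<close> and \<open>y\<close>
  similar.\<close>

lemma shift_apply [simp]: "shift k x i = x (i + k)"
  by (simp add: shift_def)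

lemma shift_shift [simp]: "shift j (shift k x) = shift (j + k) x"
  by (simp add: shift_def add.assoc)

lemma shift_0 [simp]: "shift 0 x = x"
  by (simp add: shift_def)

lemma similar_sym: "similar x y \<Longrightarrow> similar y x"
  unfolding similar_def by (metis ab_left_minus shift_0 shift_shift)

lemma similar_trans: "similar x y \<Longrightarrow> similar y z \<Longrightarrow> similar x z"
  unfolding similar_def by (metis shift_shift)

lemma closure_biseq_iff:
  fixes A :: "biseq set"
  shows "z \<in> closure A \<longleftrightarrow> (\<forall>L. \<exists>w\<in>A. \<forall>i\<in>{-L..L}. w i = z i)"
proof
  assume z: "z \<in> closure A"
  show "\<forall>L. \<exists>w\<in>A. \<forall>i\<in>{-L..L}. w i = z i"
  proof
    fix L :: int
    have "open {w :: biseq. \<forall>i\<in>{-L..L}. w i \<in> {z i}}"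
      by (rule product_topology_basis') (auto simp: open_discrete)
    with z have "A \<inter> {w :: biseq. \<forall>i\<in>{-L..L}. w i \<in> {z i}} \<noteq> {}"
      by (auto simp: closure_iff_nhds_not_empty)
    then show "\<exists>w\<in>A. \<forall>i\<in>{-L..L}. w i = z i"
      by auto
  qed
next
  assume approx: "\<forall>L. \<exists>w\<in>A. \<forall>i\<in>{-L..L}. w i = z i"
  have "A \<inter> U \<noteq> {}" if "open U" "z \<in> U" for U
  proof -
    from that obtain X where X: "z \<in> Pi\<^sub>E UNIV X" "finite {i. X i \<noteq> UNIV}" "Pi\<^sub>E UNIV X \<subseteq> U"
      using product_topology_open_contains_basis[of "\<lambda>i. euclidean" UNIV U z]
      by (auto simp: open_fun_def)
    \<comment> \<open>A sum, unlike a maximum, bounds the restricted coordinates even when there are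
      none.\<close>
    define L where "L = (\<Sum>i | X i \<noteq> UNIV. \<bar>i\<bar>)"
    have L: "\<bar>i\<bar> \<le> L" if "X i \<noteq> UNIV" for i
      unfolding L_def using that X(2) by (intro member_le_sum) auto
    obtain w where w: "w \<in> A" "\<forall>i\<in>{-L..L}. w i = z i"
      using approx by blast
    have "w i \<in> X i" for i
    proof (cases "X i = UNIV")
      case False
      from L[OF this] have "i \<in> {-L..L}" by auto
      then show ?thesis using w X(1) by (auto simp: PiE_iff)
    qed simp
    then have "w \<in> U" using X(3) by (auto simp: PiE_iff)
    with w show ?thesis by blast
  qed
  then show "z \<in> closure A"
    unfolding closure_iff_nhds_not_empty by blast
qed

lemma generated_subshift_iff:
  "z \<in> generated_subshift x \<longleftrightarrow> (\<forall>L. \<exists>k. \<forall>i\<in>{-L..L}. x (i + k) = z i)"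
  by (simp add: generated_subshift_def closure_biseq_iff)

lemma shift_in_generated_subshift: "shift k x \<in> generated_subshift x"
  unfolding generated_subshift_iff by auto

lemma generated_subshift_shift: "generated_subshift (shift k x) = generated_subshift x"
proof -
  have "z \<in> generated_subshift (shift k x)" if "z \<in> generated_subshift x" for x z k
    unfolding generated_subshift_iff
  proof
    fix L
    obtain j where "\<forall>i\<in>{-L..L}. x (i + j) = z i"
      using \<open>z \<in> _\<close> unfolding generated_subshift_iff by blast
    then have "\<forall>i\<in>{-L..L}. shift k x (i + (j - k)) = z i" by simp
    then show "\<exists>j. \<forall>i\<in>{-L..L}. shift k x (i + j) = z i" by blast
  qed
  from this[of _ x k] this[of _ "shift k x" "-k"] show ?thesis
    by auto
qed

lemma periodic_multiple:
  assumes "shift N u = u"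
  shows "u (i + N * j) = u i"
proof -
  have step: "u (i + N) = u i" for i
    using assms by (metis shift_apply)
  show ?thesis
  proof (induction j rule: int_induct[where k = 0])
    case (step1 j)
    then show ?case using step[of "i + N * j"] by (simp add: algebra_simps)
  next
    case (step2 j)
    then show ?case using step[of "i + N * (j - 1)"] by (simp add: algebra_simps)
  qed simp
qed

text \<open>\<open>N * M\<close> is a common period, and subtracting a large multiple of it moves
  any position into the half-line of agreement.\<close>

lemma periodic_eqI_left:
  assumes "shift N u = u" "shift M v = v" "N > 0" "M > 0" "\<And>i. i \<le> A \<Longrightarrow> u i = v i"
  shows "u = v"
proof
  fix i
  define j where "j = - \<bar>i\<bar> - \<bar>A\<bar>"
  have "1 \<le> N * M"
    using assms(3,4) by (simp add: int_one_le_iff_zero_less)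
  then have "j * (N * M) \<le> j * 1"
    by (intro mult_left_mono_neg) (auto simp: j_def)
  then have "i + N * (M * j) \<le> A"
    by (simp add: j_def algebra_simps)
  then have "u (i + N * (M * j)) = v (i + M * (N * j))"
    using assms(5) by (simp add: mult.left_commute)
  then show "u i = v i"
    using assms(1,2) by (simp only: periodic_multiple)
qed

lemma periodic_eqI_right:
  assumes "shift N u = u" "shift M v = v" "N > 0" "M > 0" "\<And>i. i \<ge> A \<Longrightarrow> u i = v i"
  shows "u = v"
proof
  fix i
  define j where "j = \<bar>i\<bar> + \<bar>A\<bar>"
  have "1 \<le> N * M"
    using assms(3,4) by (simp add: int_one_le_iff_zero_less)
  then have "j * 1 \<le> j * (N * M)"
    by (intro mult_left_mono) (auto simp: j_def)
  then have "i + N * (M * j) \<ge> A"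
    by (simp add: j_def algebra_simps)
  then have "u (i + N * (M * j)) = v (i + M * (N * j))"
    using assms(5) by (simp add: mult.left_commute)
  then show "u i = v i"
    using assms(1,2) by (simp only: periodic_multiple)
qed

text \<open>The equivalence makes \<open>N\<close> the least period of \<open>u\<close>, with all
  other periods as multiples. Thus \<open>k\<close> is meaningful exactly modulo
  \<open>N\<close>.\<close>

definition asymptotic_phase :: "biseq \<Rightarrow> biseq \<Rightarrow> int \<Rightarrow> int \<Rightarrow> bool" where
  "asymptotic_phase x u N k \<longleftrightarrow>
     N > 0 \<and> (\<forall>M. shift M u = u \<longleftrightarrow> N dvd M) \<and>
     (\<exists>A. \<forall>i\<le>A. x i = u i) \<and> (\<exists>B. \<forall>i\<ge>B. x i = u (i + k))"

lemma asymptotic_phase_shift: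
  assumes "asymptotic_phase x u N k"
  shows "asymptotic_phase (shift s x) (shift s u) N k"
proof -
  have N: "N > 0" and per: "shift M u = u \<longleftrightarrow> N dvd M" for M
    using assms by (auto simp: asymptotic_phase_def)
  have "shift M (shift s u) = shift s u \<longleftrightarrow> N dvd M" for M
  proof -
    have "shift M (shift s u) = shift s u \<longleftrightarrow> shift M u = u"
      by (metis ab_left_minus add.commute shift_0 shift_shift)
    then show ?thesis using per by simp
  qed
  moreover obtain A where "\<forall>i\<le>A. x i = u i" using assms by (auto simp: asymptotic_phase_def)
  then have "\<forall>i\<le>A - s. shift s x i = shift s u i" by simp
  moreover obtain B where "\<forall>i\<ge>B. x i = u (i + k)" using assms by (auto simp: asymptotic_phase_def)
  then have "\<forall>i\<ge>B - s. shift s x i = shift s u (i + k)"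
    by (simp add: add.assoc add.commute[of s])
  ultimately show ?thesis
    using N unfolding asymptotic_phase_def by blast
qed

lemma periodic_part_in_generated_subshift:
  assumes "asymptotic_phase x u N k"
  shows "shift j u \<in> generated_subshift x"
  unfolding generated_subshift_iff
proof
  fix L
  obtain A where A: "\<forall>i\<le>A. x i = u i" and N: "N > 0" and per: "shift N u = u"
    using assms by (auto simp: asymptotic_phase_def)
  \<comment> \<open>Moving by \<open>N * m\<close> keeps the phase \<open>j\<close> and puts the
    whole window to the left of \<open>A\<close>.\<close>
  define m where "m = - \<bar>L\<bar> - \<bar>A\<bar> - \<bar>j\<bar>"
  have "m * N \<le> m * 1"
    using N by (intro mult_left_mono_neg) (auto simp: m_def)
  then have "i + (j + N * m) \<le> A" if "i \<in> {-L..L}" for i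
    using that by (auto simp: m_def algebra_simps)
  then have "x (i + (j + N * m)) = u (i + j + N * m)" if "i \<in> {-L..L}" for i
    using A that by (simp add: add.assoc)
  then have "\<forall>i\<in>{-L..L}. x (i + (j + N * m)) = shift j u i"
    using periodic_multiple[OF per] by simp
  then show "\<exists>k. \<forall>i\<in>{-L..L}. x (i + k) = shift j u i"
    by blast
qed

text \<open>
  A failure of \<open>N\<close>-periodicity in a limit of shifts of \<open>y\<close> comes from one of the finitely many
  failures in \<open>y\<close>, so that only finitely many of these shifts occur.
\<close>

lemma generated_subshift_nonperiodic:
  assumes y: "asymptotic_phase y v N k" and z: "z \<in> generated_subshift y" and "\<not> periodic_seq z"
  obtains j where "z = shift j y"
proof -
  obtain A B where A: "\<forall>i\<le>A. y i = v i" and B: "\<forall>i\<ge>B. y i = v (i + k)"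
    and N: "N > 0" and per: "shift N v = v"
    using y by (auto simp: asymptotic_phase_def)
  have vN: "v (i + N) = v i" for i
    using per by (metis shift_apply)
  have defects: "i \<in> {A - N<..<B}" if "y i \<noteq> y (i + N)" for i
  proof (rule ccontr)
    assume "i \<notin> {A - N<..<B}"
    then consider "i + N \<le> A" | "i \<ge> B" by force
    then show False
    proof cases
      case 1
      then have "y i = v i" "y (i + N) = v (i + N)" using A N by auto
      with vN that show False by simp
    next
      case 2
      then have "y i = v (i + k)" "y (i + N) = v (i + k + N)"
        using B N by (auto simp: algebra_simps)
      with vN that show False by simp
    qed
  qed
  from \<open>\<not> periodic_seq z\<close> N have "shift N z \<noteq> z"
    unfolding periodic_seq_def by blast
  then obtain d where d: "z (d + N) \<noteq> z d"
    by (auto simp: fun_eq_iff)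
  \<comment> \<open>Such a window contains both \<open>d\<close> and \<open>d + N\<close>, so the
    defect of \<open>z\<close> at \<open>d\<close> shows up in \<open>y\<close>. This confines
    \<open>j\<close> to an interval that does not depend on \<open>L\<close>.\<close>
  have ex: "\<exists>j\<in>{A - N - d<..<B - d}. \<forall>i\<in>{-L..L}. y (i + j) = z i" if "L \<ge> \<bar>d\<bar> + N" for L
  proof -
    obtain j where j: "\<forall>i\<in>{-L..L}. y (i + j) = z i"
      using z unfolding generated_subshift_iff by blast
    have "d \<in> {-L..L}" "d + N \<in> {-L..L}"
      using that N by auto
    with j have "y (d + j) = z d" "y (d + N + j) = z (d + N)"
      by blast+
    then have "y (d + j) \<noteq> y (d + j + N)"
      using d by (simp add: algebra_simps)
    from defects[OF this] j show ?thesis by auto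
  qed
  have "\<exists>j\<in>{A - N - d<..<B - d}. \<forall>L. \<forall>i\<in>{-L..L}. y (i + j) = z i"
  proof (rule ccontr)
    assume "\<not> ?thesis"
    then have "\<forall>j\<in>{A - N - d<..<B - d}. \<exists>i. y (i + j) \<noteq> z i"
      by blast
    then obtain g where g: "\<And>j. j \<in> {A - N - d<..<B - d} \<Longrightarrow> y (g j + j) \<noteq> z (g j)"
      by metis
    \<comment> \<open>If every candidate \<open>j\<close> failed at some position
      \<open>g j\<close>, this window would contain all these positions and contradict
      \<open>ex\<close>.\<close>
    define L where "L = \<bar>d\<bar> + N + (\<Sum>j\<in>{A - N - d<..<B - d}. \<bar>g j\<bar>)"
    have "L \<ge> \<bar>d\<bar> + N"
      by (simp add: L_def sum_nonneg)
    from ex[OF this] obtain j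
      where j: "j \<in> {A - N - d<..<B - d}" "\<forall>i\<in>{-L..L}. y (i + j) = z i"
      by blast
    have "\<bar>g j\<bar> \<le> (\<Sum>j\<in>{A - N - d<..<B - d}. \<bar>g j\<bar>)"
      using j(1) by (intro member_le_sum) auto
    then have "g j \<in> {-L..L}"
      using N by (auto simp: L_def)
    with j g[OF j(1)] show False
      by blast
  qed
  then obtain j where "\<forall>L. \<forall>i\<in>{-L..L}. y (i + j) = z i"
    by blast
  moreover have "i \<in> {-\<bar>i\<bar>..\<bar>i\<bar>}" for i :: int
    by auto
  ultimately have "y (i + j) = z i" for i
    by blast
  then have "z = shift j y"
    by (simp add: fun_eq_iff)
  then show ?thesis ..
qed

text \<open>The image of \<open>x\<close> is a shift of \<open>y\<close>. Far to the left the code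
  sees only \<open>u\<close>, far to the right only its translate by \<open>k\<close>, so the image
  of \<open>u\<close> must be a translate of \<open>v\<close>, and the translations by
  \<open>k\<close> and by \<open>l\<close> must have the same effect on it.\<close>

lemma conjugate_asymptotic_phase:
  assumes x: "asymptotic_phase x u N k" "\<not> periodic_seq x" and y: "asymptotic_phase y v M l"
    and "conjugate (generated_subshift x) (generated_subshift y)"
  shows "N = M \<and> N dvd k - l"
proof -
  let ?X = "generated_subshift x" and ?Y = "generated_subshift y"
  obtain f where code: "sliding_block_code ?X ?Y f" and bij: "bij_betw f ?X ?Y"
    using assms by (auto simp: conjugate_def)
  obtain a b :: nat and \<Phi> where \<Phi>: "\<And>z i. z \<in> ?X \<Longrightarrow> f z i = \<Phi> (block z (i - int a) (i + int b))"
    using code unfolding sliding_block_code_def by blast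
  have xX: "shift j x \<in> ?X" and uX: "shift j u \<in> ?X" for j
    using shift_in_generated_subshift periodic_part_in_generated_subshift[OF x(1)] by auto
  \<comment> \<open>Allowing two different positions \<open>i\<close> and \<open>j\<close> covers
    both the finite window and the commutation with the shift.\<close>
  have local: "f z i = f z' j"
    if "z \<in> ?X" "z' \<in> ?X" "\<And>m. m \<in> {- int a..int b} \<Longrightarrow> z (i + m) = z' (j + m)" for z z' i j
  proof -
    have "block z (i - int a) (i + int b) = block z' (j - int a) (j + int b)"
    proof (rule nth_equalityI)
      fix n assume "n < length (block z (i - int a) (i + int b))"
      then have n: "n < nat (int a + int b + 1)"
        by (simp add: block_def algebra_simps)
      then have "z (i + (int n - int a)) = z' (j + (int n - int a))"
        using that(3)[of "int n - int a"] by auto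
      with n show "block z (i - int a) (i + int b) ! n = block z' (j - int a) (j + int b) ! n"
        by (simp add: block_def nth_upto algebra_simps)
    qed (simp add: block_def)
    then show ?thesis using \<Phi> that by simp
  qed
  have commute: "f (shift j z) = shift j (f z)" if "z \<in> ?X" "shift j z \<in> ?X" for z j
  proof
    fix i
    show "f (shift j z) i = shift j (f z) i"
      using local[OF that(2,1), of i "i + j"] by (simp add: algebra_simps)
  qed
  have inj: "f z = f z' \<longleftrightarrow> z = z'" if "z \<in> ?X" "z' \<in> ?X" for z z'
    using bij that by (auto simp: bij_betw_def inj_on_eq_iff)
  obtain A B where A: "\<forall>i\<le>A. x i = u i" and B: "\<forall>i\<ge>B. x i = u (i + k)"
    and N: "N > 0" and per: "\<And>j. shift j u = u \<longleftrightarrow> N dvd j"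
    using x(1) by (auto simp: asymptotic_phase_def)
  obtain A' B' where A': "\<forall>i\<le>A'. y i = v i" and B': "\<forall>i\<ge>B'. y i = v (i + l)"
    and M: "M > 0" and per': "\<And>j. shift j v = v \<longleftrightarrow> M dvd j"
    using y by (auto simp: asymptotic_phase_def)
  have x0: "x \<in> ?X" and u0: "u \<in> ?X"
    using xX[of 0] uX[of 0] by simp_all
  have "\<not> periodic_seq (f x)"
  proof
    assume "periodic_seq (f x)"
    then obtain K where "K > 0" "f (shift K x) = f x"
      using commute[OF x0 xX] by (auto simp: periodic_seq_def)
    with inj[OF xX x0] x(2) show False
      by (auto simp: periodic_seq_def)
  qed
  moreover have "f x \<in> ?Y"
    using bij x0 by (auto simp: bij_betw_def)
  ultimately obtain j where j: "f x = shift j y"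
    using generated_subshift_nonperiodic[OF y] by blast
  \<comment> \<open>Injectivity prevents the code from shortening the period.\<close>
  have fper: "shift i (f u) = f u \<longleftrightarrow> N dvd i" for i
    using commute[OF u0 uX] inj[OF uX u0] per by metis
  have per'': "shift i (shift m v) = shift m v \<longleftrightarrow> M dvd i" for i m
    using asymptotic_phase_shift[OF y, of m] by (simp add: asymptotic_phase_def)
  have left: "f u = shift j v"
  proof (rule periodic_eqI_left)
    show "shift N (f u) = f u"
      by (simp add: fper)
    show "shift M (shift j v) = shift j v"
      by (simp add: per'' del: shift_shift)
    show "f u i = shift j v i" if "i \<le> min (A - int b) (A' - j)" for i
    proof -
      have "f u i = f x i"
        using that A by (intro local u0 x0) auto
      also have "\<dots> = v (i + j)"
        using that A' by (simp add: j)
      finally show ?thesis by simp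
    qed
  qed (use N M in auto)
  have right: "shift k (f u) = shift (j + l) v"
  proof (rule periodic_eqI_right)
    show "shift N (shift k (f u)) = shift k (f u)"
      using fper[of N] by (metis (no_types) add.commute dvd_refl shift_shift)
    show "shift M (shift (j + l) v) = shift (j + l) v"
      by (simp add: per'' del: shift_shift)
    show "shift k (f u) i = shift (j + l) v i" if "i \<ge> max (B + int a) (B' - j)" for i
    proof -
      have "f (shift k u) i = f x i"
        using that B by (intro local uX x0) (auto simp: algebra_simps)
      also have "\<dots> = v (i + j + l)"
        using that B' by (simp add: j)
      finally show ?thesis
        using commute[OF u0 uX] by (simp add: algebra_simps)
    qed
  qed (use N M in auto)
  have "N dvd i \<longleftrightarrow> M dvd i" for i
    using fper per'' left by metis
  then have "N = M"
    using N M by (metis dvd_refl zdvd_antisym_nonneg order_less_imp_le)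
  \<comment> \<open>Inserting \<open>left\<close> into \<open>right\<close> shows that the
    translates of \<open>v\<close> by \<open>j + k\<close> and \<open>j + l\<close>
    coincide.\<close>
  moreover from left right have "shift (k - l) (shift (j + l) v) = shift (j + l) v"
    by (simp add: algebra_simps)
  then have "M dvd k - l"
    by (simp only: per'')
  ultimately show ?thesis
    by simp
qed


subsection \<open>Positions of the cells\<close>

text \<open>The increasing enumeration of the 1's, which must be unbounded in both directions. It
  turns cell counts into differences and is unique up to reindexing, so it does not matter which
  cell-series the existential definitions pick.\<close>

definition starts :: "biseq \<Rightarrow> (int \<Rightarrow> int) \<Rightarrow> bool" where
  "starts x t \<longleftrightarrow> (\<forall>n. t n < t (n + 1)) \<and> (\<forall>i. x i \<longleftrightarrow> i \<in> range t)"

lemma strict_mono_intI: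
  fixes t :: "int \<Rightarrow> int"
  assumes "\<And>n. t n < t (n + 1)"
  shows "strict_mono t"
proof (rule strict_monoI)
  fix m n :: int
  assume "m < n"
  then show "t m < t n"
    by (induction n rule: int_gr_induct) (use assms less_trans in blast)+
qed

lemma strict_mono_int_cover:
  fixes t :: "int \<Rightarrow> int"
  assumes step: "\<And>n. t n < t (n + 1)"
  shows "\<exists>n. t n \<le> i \<and> i < t (n + 1)"
proof (induction i rule: int_induct[where k = "t 0"])
  case base
  then show ?case using step[of 0] by auto
next
  case (step1 i)
  then obtain n where n: "t n \<le> i" "i < t (n + 1)" by blast
  show ?case
  proof (cases "i + 1 = t (n + 1)")
    case True
    then show ?thesis using step[of "n + 1"] by (intro exI[of _ "n + 1"]) auto
  next
    case False
    then show ?thesis using n by (intro exI[of _ n]) auto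
  qed
next
  case (step2 i)
  then obtain n where n: "t n \<le> i" "i < t (n + 1)" by blast
  show ?case
  proof (cases "i = t n")
    case True
    then show ?thesis using step[of "n - 1"] by (intro exI[of _ "n - 1"]) auto
  next
    case False
    then show ?thesis using n by (intro exI[of _ n]) auto
  qed
qed

text \<open>Two increasing enumerations of one set that share a value also share the next and the
  previous one. The inequalities \<open>succ\<close> and \<open>pred\<close> are applied with the
  roles exchanged to give equality.\<close>

lemma starts_unique:
  assumes "starts x t" "starts x t'"
  obtains k where "\<And>n. t' n = t (n + k)"
proof -
  have mono: "strict_mono t" "strict_mono t'"
    using assms by (auto simp: starts_def intro: strict_mono_intI)
  have rng: "range t = range t'"
    using assms by (auto simp: starts_def)
  have succ: "s' (n + 1) \<le> s (m + 1)"
    if s: "strict_mono s" "strict_mono s'" "range s = range s'" "s' n = s m" for s s' :: "int \<Rightarrow> int" and m n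
  proof -
    obtain a where a: "s (m + 1) = s' a" using s(3) by blast
    have "s m < s (m + 1)" using s(1) by (simp add: strict_monoD)
    then have "s' n < s' a" using s(4) a by simp
    then have "n < a" by (simp only: strict_mono_less[OF s(2)])
    then show ?thesis using a by (simp add: strict_mono_less_eq[OF s(2)])
  qed
  have pred: "s (m - 1) \<le> s' (n - 1)"
    if s: "strict_mono s" "strict_mono s'" "range s = range s'" "s' n = s m" for s s' :: "int \<Rightarrow> int" and m n
  proof -
    obtain a where a: "s (m - 1) = s' a" using s(3) by blast
    have "s (m - 1) < s m" using s(1) by (simp add: strict_monoD)
    then have "s' a < s' n" using s(4) a by simp
    then have "a < n" by (simp only: strict_mono_less[OF s(2)])
    then show ?thesis using a by (simp add: strict_mono_less_eq[OF s(2)])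
  qed
  obtain k where k: "t' 0 = t k" using rng by (metis rangeE rangeI)
  have "t' n = t (n + k)" for n
  proof (induction n rule: int_induct[where k = 0])
    case base
    then show ?case using k by simp
  next
    case (step1 n)
    then show ?case
      using succ[OF mono rng, of n "n + k"] succ[OF mono(2,1) rng[symmetric], of "n + k" n]
      by (simp add: add.commute add.left_commute)
  next
    case (step2 n)
    then show ?case
      using pred[OF mono rng, of n "n + k"] pred[OF mono(2,1) rng[symmetric], of "n + k" n]
      by (simp add: algebra_simps)
  qed
  then show ?thesis ..
qed

lemma starts_shift:
  assumes "starts x t"
  shows "starts (shift s x) (\<lambda>n. t n - s)"
proof -
  have "x (i + s) \<longleftrightarrow> i \<in> range (\<lambda>n. t n - s)" for i
  proof -
    have "i + s \<in> range t \<longleftrightarrow> i \<in> range (\<lambda>n. t n - s)"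
      by (auto simp: image_iff algebra_simps)
    then show ?thesis using assms by (auto simp: starts_def)
  qed
  then show ?thesis using assms by (auto simp: starts_def)
qed

lemma starts_reindex:
  assumes "starts x t"
  shows "starts x (\<lambda>n. t (n + k))"
proof -
  have "range (\<lambda>n. t (n + k)) = range t"
    using image_image[of t "\<lambda>n. n + k" UNIV] by (simp add: surj_plus_right)
  moreover have "t (n + k) < t (n + 1 + k)" for n
  proof -
    have "n + 1 + k = n + k + 1" by simp
    then show ?thesis using assms by (simp only: starts_def)
  qed
  ultimately show ?thesis
    using assms by (simp add: starts_def)
qed

lemma block_eq_cell_iff:
  "block x i (i + int k) = cell k \<longleftrightarrow> x i \<and> (\<forall>j\<in>{i<..i + int k}. \<not> x j)"
proof -
  have "replicate k False = map (\<lambda>_. False) [i + 1..i + int k]"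
    by (simp add: map_replicate_const)
  then show ?thesis
    by (auto simp: block_def cell_def upto_rec1)
qed

text \<open>As the cells cover all integers, reading the cells off \<open>x\<close> amounts to
  saying that the 1's are precisely at the cell starts.\<close>

lemma has_cell_series_iff:
  "has_cell_series x c \<longleftrightarrow> (\<exists>t. starts x t \<and> (\<forall>n. t (n + 1) = t n + 1 + int (c n)))"
proof -
  have "(\<forall>n. t (n + 1) = t n + int (length (cell (c n))) \<and>
             block x (t n) (t (n + 1) - 1) = cell (c n)) \<longleftrightarrow>
        starts x t \<and> (\<forall>n. t (n + 1) = t n + 1 + int (c n))" (is "?L \<longleftrightarrow> ?R") for t
  proof (cases "\<forall>n. t (n + 1) = t n + 1 + int (c n)")
    case True
    then have step: "t n < t (n + 1)" for n
      by simp
    note mono = strict_mono_intI[of t, OF step]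
    have blk: "block x (t n) (t (n + 1) - 1) = cell (c n) \<longleftrightarrow>
               x (t n) \<and> (\<forall>j\<in>{t n<..<t (n + 1)}. \<not> x j)" for n
    proof -
      have "t (n + 1) - 1 = t n + int (c n)" "{t n<..t n + int (c n)} = {t n<..<t (n + 1)}"
        using True by auto
      then show ?thesis by (simp add: block_eq_cell_iff)
    qed
    have "(\<forall>n. x (t n) \<and> (\<forall>j\<in>{t n<..<t (n + 1)}. \<not> x j)) \<longleftrightarrow> (\<forall>i. x i \<longleftrightarrow> i \<in> range t)"
    proof safe
      fix i
      assume cells: "\<forall>n. x (t n) \<and> (\<forall>j\<in>{t n<..<t (n + 1)}. \<not> x j)" and "x i"
      obtain n where n: "t n \<le> i" "i < t (n + 1)"
        using strict_mono_int_cover[of t, OF step] by blast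
      with cells \<open>x i\<close> have "i = t n"
        by (metis greaterThanLessThan_iff order_le_less)
      then show "i \<in> range t" by blast
    next
      fix n j
      assume "\<forall>i. x i \<longleftrightarrow> i \<in> range t" "j \<in> {t n<..<t (n + 1)}" "x j"
      then obtain a where "t n < t a" "t a < t (n + 1)" by auto
      then have "n < a" "a < n + 1"
        using strict_mono_less[OF mono] by blast+
      then show False by simp
    qed auto
    then show ?thesis
      using True step unfolding starts_def blk by (simp add: cell_def)
  next
    case False
    then show ?thesis by (auto simp: cell_def)
  qed
  then show ?thesis by (simp add: has_cell_series_def)
qed

text \<open>Of the \<open>t (r + int m) - t r\<close> symbols of the chain, one per cell is a
  1.\<close>

lemma zeros_chain:
  assumes t: "\<And>n. t (n + 1) = t n + 1 + int (c n)"
  shows "int (zeros (chain c r (r + int m - 1))) = t (r + int m) - t r - int m"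
proof (induction m)
  case 0
  then show ?case by (simp add: zeros_def chain_def)
next
  case (Suc m)
  have "[r..r + int (Suc m) - 1] = [r..r + int m - 1] @ [r + int m]"
    by (simp add: upto_rec2)
  then have "zeros (chain c r (r + int (Suc m) - 1)) =
      zeros (chain c r (r + int m - 1)) + zeros (cell (c (r + int m)))"
    by (simp add: zeros_def chain_def)
  moreover have "zeros (cell k) = k" for k
    by (induction k) (auto simp: zeros_def cell_def)
  ultimately show ?case
    using Suc t[of "r + int m"] by (simp add: algebra_simps)
qed

lemma sturmian_iff:
  assumes "starts x t"
  shows "sturmian x \<longleftrightarrow>
    (\<forall>m>0. \<forall>r s. \<bar>(t (r + int m) - t r) - (t (s + int m) - t s)\<bar> \<le> 1)" (is "_ \<longleftrightarrow> ?bal t")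
proof
  assume "sturmian x"
  then obtain c t' where t': "starts x t'" "\<And>n. t' (n + 1) = t' n + 1 + int (c n)"
    and bal: "\<forall>m>0. \<forall>r s. \<bar>int (zeros (chain c r (r + int m - 1))) -
                        int (zeros (chain c s (s + int m - 1)))\<bar> \<le> 1"
    unfolding sturmian_def has_cell_series_iff by blast
  obtain k where k: "\<And>n. t n = t' (n + k)"
    using starts_unique t'(1) assms by metis
  show "?bal t"
  proof (intro allI impI)
    fix m :: nat and r s :: int
    assume "m > 0"
    with bal have "\<bar>int (zeros (chain c (r + k) (r + k + int m - 1))) -
                        int (zeros (chain c (s + k) (s + k + int m - 1)))\<bar> \<le> 1"
      by blast
    moreover have "int (zeros (chain c (r + k) (r + k + int m - 1))) = t (r + int m) - t r - int m" for r
      using zeros_chain[of t' c, OF t'(2), of "r + k" m] by (simp add: k add.assoc add.commute[of k])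
    ultimately show "\<bar>(t (r + int m) - t r) - (t (s + int m) - t s)\<bar> \<le> 1"
      by simp
  qed
next
  assume bal: "?bal t"
  define c where "c n = nat (t (n + 1) - t n - 1)" for n
  have c: "t (n + 1) = t n + 1 + int (c n)" for n
    using assms by (auto simp: starts_def c_def)
  have "has_cell_series x c"
    unfolding has_cell_series_iff using assms c by blast
  with bal show "sturmian x"
    unfolding sturmian_def by (intro exI[of _ c]) (simp only: zeros_chain[of t c, OF c], simp add: algebra_simps)
qed

text \<open>The quotient is the mean cell length, which counts the leading 1 of each cell besides
  its 0's.\<close>

lemma has_finite_frequency_iff:
  assumes "starts x t"
  shows "has_finite_frequency x \<alpha> \<longleftrightarrow>
    (\<forall>r. (\<lambda>n. real_of_int (t (r n + int n) - t (r n)) / real n) \<longlonglongrightarrow> 1 + \<alpha>)" (is "_ \<longleftrightarrow> ?freq t")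
proof -
  have freq: "(\<forall>r. (\<lambda>n. real (zeros (chain c (r n) (r n + int n - 1))) / real n) \<longlonglongrightarrow> \<alpha>) \<longleftrightarrow> ?freq t"
    if t: "\<And>n. t (n + 1) = t n + 1 + int (c n)" for c and t :: "int \<Rightarrow> int"
  proof -
    have "(\<lambda>n. real (zeros (chain c (r n) (r n + int n - 1))) / real n) \<longlonglongrightarrow> \<alpha> \<longleftrightarrow>
          (\<lambda>n. real_of_int (t (r n + int n) - t (r n)) / real n) \<longlonglongrightarrow> 1 + \<alpha>" for r
    proof -
      \<comment> \<open>The case \<open>n = 0\<close> is excluded: division by zero would give 1 on
        the left and 0 on the right.\<close>
      have *: "1 + real (zeros (chain c (r n) (r n + int n - 1))) / real n =
            real_of_int (t (r n + int n) - t (r n)) / real n" if "n > 0" for n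
      proof -
        have "real (zeros (chain c (r n) (r n + int n - 1))) =
              real_of_int (t (r n + int n) - t (r n)) - real n"
          using zeros_chain[of t c, OF t, of "r n" n]
          by (metis of_int_diff of_int_of_nat_eq)
        then show ?thesis using that by (simp add: field_simps)
      qed
      have "(\<lambda>n. real (zeros (chain c (r n) (r n + int n - 1))) / real n) \<longlonglongrightarrow> \<alpha> \<longleftrightarrow>
            (\<lambda>n. 1 + real (zeros (chain c (r n) (r n + int n - 1))) / real n) \<longlonglongrightarrow> 1 + \<alpha>"
        by (simp add: tendsto_add_const_iff)
      also have "\<dots> \<longleftrightarrow> (\<lambda>n. real_of_int (t (r n + int n) - t (r n)) / real n) \<longlonglongrightarrow> 1 + \<alpha>"
        using * by (intro tendsto_cong eventually_mono[OF eventually_gt_at_top[of 0]])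
      finally show ?thesis .
    qed
    then show ?thesis by blast
  qed
  define c where "c n = nat (t (n + 1) - t n - 1)" for n
  have c: "t (n + 1) = t n + 1 + int (c n)" for n
    using assms by (auto simp: starts_def c_def)
  have "has_cell_series x c"
    unfolding has_cell_series_iff using assms c by blast
  moreover have "?freq t" if c': "has_cell_series x c'"
    "\<forall>r :: nat \<Rightarrow> int. (\<lambda>n. real (zeros (chain c' (r n) (r n + int n - 1))) / real n) \<longlonglongrightarrow> \<alpha>" for c'
  proof
    obtain t' where t': "starts x t'" "\<And>n. t' (n + 1) = t' n + 1 + int (c' n)"
      using c'(1) unfolding has_cell_series_iff by blast
    obtain k where k: "\<And>n. t n = t' (n + k)"
      using starts_unique t'(1) assms by metis
    fix r :: "nat \<Rightarrow> int"
    have "(\<lambda>n. real_of_int (t' (r n + k + int n) - t' (r n + k)) / real n) \<longlonglongrightarrow> 1 + \<alpha>"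
      using freq[of t' c', OF t'(2)] c'(2) by auto
    then show "(\<lambda>n. real_of_int (t (r n + int n) - t (r n)) / real n) \<longlonglongrightarrow> 1 + \<alpha>"
      by (simp add: k algebra_simps)
  qed
  ultimately show ?thesis
    unfolding has_finite_frequency_def using freq[of t c, OF c] by blast
qed


subsection \<open>The standard skew words\<close>

text \<open>
  \<open>skew_word b p N\<close> has period \<open>N\<close> with \<open>p\<close> symbols 1 on either side; it is of type \<open>S\<close> if \<open>b\<close> and of
  type \<open>S'\<close> otherwise. The two branches are the mechanical words that resolve the coincidences of
  grid points with integers in opposite ways. The separate value at 1 makes the cases \<open>p = 0\<close> and
  \<open>p = N\<close> (both with \<open>N = 1\<close>) come out as the single one and the single zero.
\<close>

definition skew_word :: "bool \<Rightarrow> int \<Rightarrow> int \<Rightarrow> biseq" where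
  "skew_word b p N i = (if i = 1 then b else if (i \<le> 0) = b then (p * i - 1) mod N < p
                        else (p * i) mod N < p)"

text \<open>The values are \<open>\<lfloor>n N / p\<rfloor> + 1\<close> and \<open>\<lceil>n N / p\<rceil>\<close>, which differ only if \<open>p\<close> divides \<open>n N\<close>.\<close>

definition skew_start :: "bool \<Rightarrow> int \<Rightarrow> int \<Rightarrow> int \<Rightarrow> int" where
  "skew_start b p N n = (if (n \<le> 0) = b then n * N div p + 1 else - ((- (n * N)) div p))"

text \<open>Coprimality leaves \<open>p = 0\<close> and \<open>p = N\<close> only with
  \<open>N = 1\<close>. The last condition discards the constant words
  \<open>skew_word True 1 1\<close> and \<open>skew_word False 0 1\<close>.\<close>

definition skew_params :: "bool \<Rightarrow> int \<Rightarrow> int \<Rightarrow> bool" where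
  "skew_params b p N \<longleftrightarrow> 0 \<le> p \<and> p \<le> N \<and> N > 0 \<and> coprime p N \<and> (if b then p < N else 0 < p)"

lemma int_div_eq_iff: "0 < p \<Longrightarrow> a div p = j \<longleftrightarrow> p * j \<le> a \<and> a < p * j + p" for a p j :: int
proof -
  assume p: "0 < p"
  have "p * (a div p) \<le> a \<and> a < p * (a div p) + p"
    using pos_mod_bound[OF p, of a] pos_mod_sign[OF p, of a] mult_div_mod_eq[of p a] by linarith
  moreover have "a div p = j" if "p * j \<le> a" "a < p * j + p"
    using that by (intro int_div_pos_eq[of a p j "a - p * j"]) auto
  ultimately show ?thesis by blast
qed

lemma int_mod_less_iff:
  fixes a p N :: int
  assumes "0 < p" "p \<le> N"
  shows "a mod N < p \<longleftrightarrow> (\<exists>n. n * N \<le> a \<and> a < n * N + p)"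
proof
  assume "a mod N < p"
  moreover have "(a div N) * N + a mod N = a" "0 \<le> a mod N"
    using assms by auto
  ultimately show "\<exists>n. n * N \<le> a \<and> a < n * N + p"
    by (intro exI[of _ "a div N"]) linarith
next
  assume "\<exists>n. n * N \<le> a \<and> a < n * N + p"
  then obtain n where n: "n * N \<le> a" "a < n * N + p" by blast
  then have "a mod N = a - n * N"
    using assms by (intro int_mod_pos_eq[of a N n]) (auto simp: mult.commute)
  with n show "a mod N < p" by simp
qed

text \<open>This removes the divisions: \<open>p * i - n * N\<close> lies in one of two half-open
  intervals of length \<open>p\<close>, which differ only in the endpoint that they contain.\<close>

lemma skew_start_eq_iff:
  assumes "0 < p"
  shows "skew_start b p N n = i \<longleftrightarrow>
    (if (n \<le> 0) = b then n * N < p * i \<and> p * i \<le> n * N + p else n * N \<le> p * i \<and> p * i < n * N + p)"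
proof -
  have "n * N div p + 1 = i \<longleftrightarrow> n * N div p = i - 1" "- ((- (n * N)) div p) = i \<longleftrightarrow> (- (n * N)) div p = - i"
    by auto
  then have "n * N div p + 1 = i \<longleftrightarrow> n * N < p * i \<and> p * i \<le> n * N + p"
    "- ((- (n * N)) div p) = i \<longleftrightarrow> n * N \<le> p * i \<and> p * i < n * N + p"
    unfolding int_div_eq_iff[OF assms] right_diff_distrib mult_minus_right by linarith+
  then show ?thesis
    by (simp add: skew_start_def)
qed

text \<open>Positions \<open>i \<le> 0\<close> can be starts only of cells \<open>n \<le> 0\<close>,
  and positions \<open>i \<ge> 2\<close> only of cells \<open>n > 0\<close>, so a single branch is
  relevant on each side. Position 1 is start number 0 if \<open>b\<close> holds and falls into the
  gap between the branches otherwise.\<close>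

lemma range_skew_start:
  assumes p: "0 < p" "p \<le> N"
  shows "i \<in> range (skew_start b p N) \<longleftrightarrow> skew_word b p N i"
proof -
  have rng: "i \<in> range (skew_start b p N) \<longleftrightarrow> (\<exists>n. skew_start b p N n = i)"
    by auto
  have "n * N \<le> p * i - 1 \<and> p * i - 1 < n * N + p \<longleftrightarrow> n * N < p * i \<and> p * i \<le> n * N + p" for n
    by linarith
  then have upper: "(p * i - 1) mod N < p \<longleftrightarrow> (\<exists>n. n * N < p * i \<and> p * i \<le> n * N + p)"
    by (simp only: int_mod_less_iff[OF p])
  have lower: "(p * i) mod N < p \<longleftrightarrow> (\<exists>n. n * N \<le> p * i \<and> p * i < n * N + p)"
    by (rule int_mod_less_iff[OF p])
  have nonpos: "n * N \<le> 0" if "n \<le> 0" for n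
    using that p by (simp add: mult_le_0_iff)
  have pos: "N \<le> n * N" if "\<not> n \<le> 0" for n
    using that p mult_right_mono[of 1 n N] by simp
  consider "i \<le> 0" | "i = 1" | "i \<ge> 2" by linarith
  then show ?thesis
  proof cases
    case 1
    then have pi: "p * i \<le> 0" using p by (simp add: mult_le_0_iff)
    then have "n \<le> 0" if "n * N \<le> p * i" for n
      using pos[of n] p that by linarith
    then have "(n \<le> 0) = b \<longleftrightarrow> b" if "n * N \<le> p * i" for n
      using that by auto
    then show ?thesis
      unfolding rng skew_start_eq_iff[OF p(1)] skew_word_def upper lower
      using 1 by (smt (verit))
  next
    case 2
    show ?thesis
    proof (cases b)
      case True
      then show ?thesis
        unfolding rng skew_start_eq_iff[OF p(1)] skew_word_def
        using 2 p by (auto intro!: exI[of _ 0])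
    next
      case False
      then have "\<not> (\<exists>n. skew_start b p N n = 1)"
        unfolding skew_start_eq_iff[OF p(1)] using nonpos pos p by (smt (verit) mult.right_neutral)
      then show ?thesis
        using rng 2 False by (simp add: skew_word_def)
    qed
  next
    case 3
    then have pi: "2 * p \<le> p * i" using p by (simp add: mult.commute)
    then have "\<not> n \<le> 0" if "p * i \<le> n * N + p" for n
      using nonpos[of n] p that by linarith
    then have "(n \<le> 0) = b \<longleftrightarrow> \<not> b" if "p * i \<le> n * N + p" for n
      using that by auto
    then show ?thesis
      unfolding rng skew_start_eq_iff[OF p(1)] skew_word_def upper lower
      using 3 by (smt (verit))
  qed
qed

lemma skew_start_bounds:
  assumes "0 < p"
  shows "n * N \<le> p * skew_start b p N n" "p * skew_start b p N n \<le> n * N + p"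
  using skew_start_eq_iff[OF assms, of b N n "skew_start b p N n"] by (auto split: if_splits)

lemma starts_skew_word:
  assumes "skew_params b p N" "0 < p"
  shows "starts (skew_word b p N) (skew_start b p N)"
proof -
  have p: "p \<le> N" "b \<longrightarrow> p < N" using assms by (auto simp: skew_params_def)
  have "skew_start b p N n < skew_start b p N (n + 1)" for n
  proof -
    let ?s = "skew_start b p N n" and ?s' = "skew_start b p N (n + 1)"
    have s: "if (n \<le> 0) = b then n * N < p * ?s \<and> p * ?s \<le> n * N + p else n * N \<le> p * ?s \<and> p * ?s < n * N + p"
      using skew_start_eq_iff[OF assms(2)] by blast
    have s': "if (n + 1 \<le> 0) = b then (n + 1) * N < p * ?s' \<and> p * ?s' \<le> (n + 1) * N + p
       else (n + 1) * N \<le> p * ?s' \<and> p * ?s' < (n + 1) * N + p"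
      using skew_start_eq_iff[OF assms(2)] by blast
    \<comment> \<open>The branch changes only between 0 and 1. If \<open>b\<close> holds, the bounds
      there are \<open>p * ?s \<le> p\<close> and \<open>N \<le> p * ?s'\<close>, which is where
      \<open>p < N\<close> is needed.\<close>
    consider "n = 0" "b" | "n = 0" "\<not> b" | "(n \<le> 0) = (n + 1 \<le> 0)" by linarith
    then have "p * ?s < p * ?s'"
    proof cases
      case 1
      then have "n * N = 0" "(n + 1) * N = N" by simp_all
      then show ?thesis using 1 s s' p by (smt (verit))
    next
      case 2
      then have "n * N = 0" "(n + 1) * N = N" by simp_all
      then show ?thesis using 2 s s' p by (smt (verit))
    next
      case 3
      moreover have "(n + 1) * N = n * N + N" by (simp add: distrib_right)
      ultimately show ?thesis using s s' p by (smt (verit))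
    qed
    then show ?thesis using assms(2) by simp
  qed
  then show ?thesis
    using range_skew_start[OF assms(2) p(1)] by (auto simp: starts_def)
qed

text \<open>Replacing \<open>p\<close> by \<open>N - p\<close> turns the residue \<open>r\<close> in
  one branch into \<open>N - 1 - r\<close> in the other, and \<open>N - 1 - r < N - p\<close> is the
  negation of \<open>r < p\<close>.\<close>

lemma skew_word_compl:
  assumes "N > 0"
  shows "(\<not> skew_word b p N i) = skew_word (\<not> b) (N - p) N i"
proof -
  have neg: "(- 1 - a) mod N = N - 1 - a mod N" for a
  proof (rule int_mod_pos_eq[of _ _ "- (a div N) - 1"])
    show "- 1 - a = N * (- (a div N) - 1) + (N - 1 - a mod N)"
      using mult_div_mod_eq[of N a] by (simp add: algebra_simps)
  qed (use assms pos_mod_bound[OF assms, of a] pos_mod_sign[OF assms, of a] in linarith)+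
  have "((N - p) * i - 1) mod N = (- 1 - p * i + N * i) mod N" "((N - p) * i) mod N = (- 1 - (p * i - 1) + N * i) mod N"
    by (simp_all add: algebra_simps)
  then have "((N - p) * i - 1) mod N = N - 1 - (p * i) mod N" "((N - p) * i) mod N = N - 1 - (p * i - 1) mod N"
    using neg by (simp_all only: mod_mult_self2)
  then show ?thesis
    by (auto simp: skew_word_def)
qed

lemma skew_params_compl:
  assumes "skew_params b p N"
  shows "skew_params (\<not> b) (N - p) N"
proof -
  have "coprime (N - p) N"
  proof (rule coprimeI)
    fix d assume d: "d dvd N - p" "d dvd N"
    from dvd_diff[OF d(2,1)] have "d dvd p" by simp
    then show "is_unit d"
      using assms d(2) unfolding skew_params_def by (metis coprime_common_divisor)
  qed
  then show ?thesis
    using assms by (simp add: skew_params_def split: if_splits)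
qed

lemma conjugate_compl: "conjugate (generated_subshift x) (generated_subshift (\<lambda>i. \<not> x i))"
proof -
  define f :: "biseq \<Rightarrow> biseq" where "f z = (\<lambda>i. \<not> z i)" for z
  have f: "f z \<in> generated_subshift (f x)" if "z \<in> generated_subshift x" for x z
    using that by (simp add: generated_subshift_iff f_def)
  have ff: "f (f z) = z" for z
    by (simp add: f_def)
  have "bij_betw f (generated_subshift x) (generated_subshift (f x))"
    using f[of _ x] f[of _ "f x"] by (intro bij_betw_byWitness[where f' = f]) (auto simp: ff)
  moreover have "sliding_block_code (generated_subshift x) (generated_subshift (f x)) f"
    unfolding sliding_block_code_def
    using f by (auto intro!: exI[of _ 0] exI[of _ "\<lambda>w. \<not> hd w"] simp: block_def f_def)
  ultimately show ?thesis
    by (auto simp: conjugate_def f_def)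
qed

text \<open>A nonempty proper arc of the residues has only trivial translations. With
  \<open>t\<close> the residue of \<open>s\<close>, taking \<open>r = 0\<close> puts
  \<open>t\<close> into the arc; if \<open>t\<close> were positive, \<open>r = p - t\<close> would
  lie in the arc but be moved to \<open>p\<close>, just outside it.\<close>

lemma mod_less_translation_invariant:
  fixes p N s :: int
  assumes "0 < p" "p < N" "\<And>r. (r + s) mod N < p \<longleftrightarrow> r mod N < p"
  shows "N dvd s"
proof -
  define t where "t = s mod N"
  have t: "0 \<le> t" "t < N" using assms by (auto simp: t_def)
  have r: "(r + t) mod N < p \<longleftrightarrow> r mod N < p" for r
    using assms(3)[of r] by (simp add: t_def mod_add_right_eq)
  have "t < p" using r[of 0] t assms by simp
  moreover have "t = 0" if "t < p"
    using r[of "p - t"] that t assms by auto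
  ultimately show ?thesis by (simp add: t_def dvd_eq_mod_eq_0)
qed

lemma asymptotic_phase_skew_word:
  assumes "skew_params b p N"
  obtains u k where "asymptotic_phase (skew_word b p N) u N k"
    "N dvd p * k - (if b then 1 else - 1)"
proof -
  have p: "0 \<le> p" "p \<le> N" "N > 0" "coprime p N" "if b then p < N else 0 < p"
    using assms by (auto simp: skew_params_def)
  obtain c d where "c * p + d * N = 1"
    using bezout_int[of p N] p(4) by (auto simp: coprime_iff_gcd_eq_1)
  \<comment> \<open>The left branch subtracts \<open>e\<close>, the right one \<open>1 - e\<close>.
    Translation by \<open>k\<close> joins them if \<open>p * k\<close> is \<open>2 * e - 1\<close>
    modulo \<open>N\<close>, and \<open>c\<close> is the inverse of \<open>p\<close>.\<close>
  define e :: int where "e = (if b then 1 else 0)"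
  define k where "k = (2 * e - 1) * c"
  define u :: biseq where "u i \<longleftrightarrow> (p * i - e) mod N < p" for i
  have pk: "p * k = 2 * e - 1 + N * (- d * (2 * e - 1))"
  proof -
    have "p * k = (2 * e - 1) * (c * p)" by (simp add: k_def)
    also have "c * p = 1 - d * N" using \<open>c * p + d * N = 1\<close> by simp
    finally show ?thesis by (simp add: algebra_simps)
  qed
  have right: "u (i + k) \<longleftrightarrow> (p * i - (1 - e)) mod N < p" for i
  proof -
    have "p * (i + k) - e = p * i - (1 - e) + N * (- d * (2 * e - 1))"
      using pk by (simp add: algebra_simps)
    then show ?thesis by (simp only: u_def mod_mult_self2)
  qed
  have "shift M u = u \<longleftrightarrow> N dvd M" for M
  proof
    assume "N dvd M"
    then obtain j where "M = N * j" by blast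
    then have "p * (i + M) - e = p * i - e + N * (p * j)" for i
      by (simp add: algebra_simps)
    then show "shift M u = u"
      by (simp only: fun_eq_iff shift_apply u_def mod_mult_self2) simp
  next
    assume per: "shift M u = u"
    show "N dvd M"
    proof (cases "0 < p \<and> p < N")
      case True
      have "(r + p * M) mod N < p \<longleftrightarrow> r mod N < p" for r
      proof -
        \<comment> \<open>This solves \<open>p * i - e = r\<close> modulo \<open>N\<close>, so every
          residue is reached and a period \<open>M\<close> of \<open>u\<close> becomes the
          translation of the arc by \<open>p * M\<close>.\<close>
        define i where "i = (r + e) * c"
        have i: "p * i - e = r + N * (- d * (r + e))"
        proof -
          have "p * i = (r + e) * (c * p)" by (simp add: i_def)
          also have "c * p = 1 - d * N" using \<open>c * p + d * N = 1\<close> by simp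
          finally show ?thesis by (simp add: algebra_simps)
        qed
        have "p * (i + M) - e = r + p * M + N * (- d * (r + e))"
          using i by (simp add: algebra_simps)
        then have "u (i + M) \<longleftrightarrow> (r + p * M) mod N < p"
          by (simp only: u_def mod_mult_self2)
        moreover have "u i \<longleftrightarrow> r mod N < p"
          using i by (simp only: u_def mod_mult_self2)
        ultimately show ?thesis
          using per by (metis shift_apply)
      qed
      then have "N dvd p * M"
        using True by (intro mod_less_translation_invariant[of p]) auto
      then show ?thesis
        using p(4) by (simp add: coprime_dvd_mult_right_iff coprime_commute)
    next
      case False
      then have "p = 0 \<or> p = N" using p by auto
      then have "N = 1" using p by (auto simp: coprime_iff_gcd_eq_1)
      then show ?thesis by simp
    qed
  qed
  moreover have "\<forall>i\<le>0. skew_word b p N i = u i"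
    by (auto simp: skew_word_def u_def e_def)
  moreover have "\<forall>i\<ge>2. skew_word b p N i = u (i + k)"
    by (auto simp: right skew_word_def e_def)
  ultimately have "asymptotic_phase (skew_word b p N) u N k"
    using p(3) unfolding asymptotic_phase_def by blast
  moreover have "p * k - (if b then 1 else - 1) = N * (- d * (2 * e - 1))"
    using pk by (simp add: e_def)
  then have "N dvd p * k - (if b then 1 else - 1)"
    by (metis dvd_triv_left)
  ultimately show ?thesis ..
qed


subsection \<open>Frequencies and types\<close>

text \<open>The cell lengths determine the starts up to an additive constant, that is, the sequence
  up to a shift. The offset \<open>k\<close> of the index absorbs the parameter \<open>m\<close> of
  the cell-series.\<close>

lemma similar_iff_increments:
  assumes y: "starts y s" and c: "\<And>n. int (c n) = s (n + k + 1) - s (n + k) - 1"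
  shows "has_cell_series x c \<longleftrightarrow> similar y x"
proof
  assume "has_cell_series x c"
  then obtain t where t: "starts x t" "\<And>n. t (n + 1) = t n + 1 + int (c n)"
    unfolding has_cell_series_iff by blast
  define d where "d = t 0 - s k"
  have tn: "t n = s (n + k) + d" for n
  proof (induction n rule: int_induct[where k = 0])
    case base
    then show ?case by (simp add: d_def)
  next
    case (step1 n)
    then show ?case using t(2)[of n] c[of n] by (simp add: algebra_simps)
  next
    case (step2 n)
    then show ?case using t(2)[of "n - 1"] c[of "n - 1"] by (simp add: algebra_simps)
  qed
  have "x i \<longleftrightarrow> y (i - d)" for i
  proof -
    have "x i \<longleftrightarrow> (\<exists>n. i = s (n + k) + d)"
      using t(1) by (auto simp: starts_def image_iff tn)
    also have "\<dots> \<longleftrightarrow> (\<exists>n. i - d = s (n + k))"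
      by (simp add: diff_eq_eq)
    also have "\<dots> \<longleftrightarrow> y (i - d)"
      using y starts_reindex[OF y, of k] by (auto simp: starts_def image_iff)
    finally show ?thesis .
  qed
  then have "shift (- d) y = x" by (auto simp: fun_eq_iff)
  then show "similar y x" unfolding similar_def by blast
next
  assume "similar y x"
  then obtain d where "shift d y = x" unfolding similar_def by blast
  then have "starts x (\<lambda>n. s (n + k) - d)"
    using starts_shift[OF starts_reindex[OF y], of d k] by simp
  then show "has_cell_series x c"
    unfolding has_cell_series_iff by (rule exI[of _ "\<lambda>n. s (n + k) - d", OF conjI]) (simp add: c algebra_simps)
qed

lemma similar_has_frequency:
  assumes "similar x y" "has_frequency x a"
  shows "has_frequency y a"
proof -
  obtain k where k: "shift k x = y"
    using assms(1) by (auto simp: similar_def)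
  have "has_finite_frequency y \<alpha>" if freq: "has_finite_frequency x \<alpha>" for \<alpha>
  proof -
    obtain t where t: "starts x t"
      using freq by (auto simp: has_finite_frequency_def has_cell_series_iff)
    from starts_shift[OF this, of k] have "starts y (\<lambda>n. t n - k)"
      by (simp add: k)
    with freq show ?thesis
      by (simp add: has_finite_frequency_iff[OF t] has_finite_frequency_iff[of y])
  qed
  moreover have "single_one y" if "single_one x"
  proof -
    obtain j where "\<forall>i. x i \<longleftrightarrow> i = j" using \<open>single_one x\<close> by (auto simp: single_one_def)
    then have "\<forall>i. y i \<longleftrightarrow> i = j - k" using k by auto
    then show ?thesis unfolding single_one_def by blast
  qed
  ultimately show ?thesis
    using assms(2) by (auto simp: has_frequency_def)
qed

lemma not_single_one_of_starts:
  assumes "starts x t"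
  shows "\<not> single_one x"
proof
  assume "single_one x"
  then obtain j where j: "\<forall>i. x i \<longleftrightarrow> i = j" by (auto simp: single_one_def)
  have "x (t 0)" "x (t 1)" using assms by (auto simp: starts_def)
  with j have "t 0 = t 1" by simp
  moreover have "t 0 < t (0 + 1)" using assms unfolding starts_def by blast
  ultimately show False by simp
qed

lemma has_frequency_unique:
  assumes "has_frequency x a" "has_frequency x b"
  shows "a = b"
proof -
  have ex: "\<exists>t. starts x t" if "has_finite_frequency x \<alpha>" for \<alpha>
    using that by (auto simp: has_finite_frequency_def has_cell_series_iff)
  have "\<alpha> = \<beta>" if "has_finite_frequency x \<alpha>" "has_finite_frequency x \<beta>" for \<alpha> \<beta>
  proof -
    from ex[OF that(1)] obtain t where t: "starts x t" by blast
    have "1 + \<alpha> = 1 + \<beta>"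
      using that unfolding has_finite_frequency_iff[OF t] by (blast intro: LIMSEQ_unique)
    then show ?thesis by simp
  qed
  moreover have "\<not> single_one x" if "has_finite_frequency x \<alpha>" for \<alpha>
    using ex[OF that] not_single_one_of_starts by blast
  ultimately show ?thesis
    using assms by (auto simp: has_frequency_def)
qed

lemma single_one_iff_similar: "single_one x \<longleftrightarrow> similar (skew_word True 0 1) x"
proof -
  have w: "skew_word True 0 1 i \<longleftrightarrow> i = 1" for i
    by (simp add: skew_word_def)
  show ?thesis
  proof
    assume "single_one x"
    then obtain k where "\<forall>i. x i \<longleftrightarrow> i = k" by (auto simp: single_one_def)
    then have "shift (1 - k) (skew_word True 0 1) = x" by (intro ext) (simp add: w)
    then show "similar (skew_word True 0 1) x" unfolding similar_def by blast
  next
    assume "similar (skew_word True 0 1) x"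
    then obtain k where "shift k (skew_word True 0 1) = x" by (auto simp: similar_def)
    then have "\<forall>i. x i \<longleftrightarrow> i = 1 - k" by (auto simp: w)
    then show "single_one x" unfolding single_one_def by blast
  qed
qed

lemma single_zero_iff_similar: "single_zero x \<longleftrightarrow> similar (skew_word False 1 1) x"
proof -
  have w: "skew_word False 1 1 i \<longleftrightarrow> i \<noteq> 1" for i
    by (simp add: skew_word_def)
  show ?thesis
  proof
    assume "single_zero x"
    then obtain k where "\<forall>i. x i \<longleftrightarrow> i \<noteq> k" by (auto simp: single_zero_def)
    then have "shift (1 - k) (skew_word False 1 1) = x" by (intro ext) (simp add: w)
    then show "similar (skew_word False 1 1) x" unfolding similar_def by blast
  next
    assume "similar (skew_word False 1 1) x"
    then obtain k where "shift k (skew_word False 1 1) = x" by (auto simp: similar_def)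
    then have "\<forall>i. x i \<longleftrightarrow> i \<noteq> 1 - k" by (auto simp: w)
    then show "single_zero x" unfolding single_zero_def by blast
  qed
qed

text \<open>For \<open>p = 0\<close> the extended quotient is \<open>1 / 0 = \<infinity>\<close>.
  For \<open>p > 0\<close> the length of \<open>n\<close> consecutive cells differs from
  \<open>n * N / p\<close> by at most 1, wherever they begin.\<close>

lemma has_frequency_skew_word:
  assumes "skew_params b p N"
  shows "has_frequency (skew_word b p N) (ereal (of_int (N - p)) / ereal (of_int p))"
proof (cases "p = 0")
  case True
  then have "b" "N = 1"
    using assms by (auto simp: skew_params_def split: if_splits)
  moreover have "single_one (skew_word True 0 1)"
    by (auto simp: single_one_def skew_word_def intro!: exI[of _ 1])
  ultimately show ?thesis
    using True by (simp add: has_frequency_def)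
next
  case False
  then have p: "p > 0" using assms by (auto simp: skew_params_def)
  let ?t = "skew_start b p N"
  have "(\<lambda>n. real_of_int (?t (r n + int n) - ?t (r n)) / real n) \<longlonglongrightarrow> of_int N / of_int p" for r
  proof (rule LIM_zero_cancel, rule Lim_null_comparison)
    show "\<forall>\<^sub>F n in sequentially.
      norm (real_of_int (?t (r n + int n) - ?t (r n)) / real n - of_int N / of_int p) \<le> 1 / real n"
    proof (rule eventually_mono[OF eventually_gt_at_top[of 0]])
      fix n :: nat assume n: "0 < n"
      define D where "D = ?t (r n + int n) - ?t (r n)"
      have "p * D \<le> N * int n + p" "N * int n - p \<le> p * D"
        using skew_start_bounds[OF p, where b = b and N = N and n = "r n"]
          skew_start_bounds[OF p, where b = b and N = N and n = "r n + int n"]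
        by (simp_all add: D_def algebra_simps)
      then have "\<bar>p * D - N * int n\<bar> \<le> p" by linarith
      then have "\<bar>real_of_int (p * D - N * int n)\<bar> \<le> real_of_int p" by linarith
      then have "\<bar>real_of_int (p * D - N * int n) / (of_int p * real n)\<bar> \<le> of_int p / (of_int p * real n)"
        using p n unfolding abs_divide by (intro frac_le) auto
      moreover have "real_of_int (p * D - N * int n) / (of_int p * real n) = of_int D / real n - of_int N / of_int p"
        using p n by (simp add: field_simps)
      ultimately have "norm (of_int D / real n - of_int N / of_int p) \<le> of_int p / (of_int p * real n)"
        by (metis real_norm_def)
      then show "norm (real_of_int (?t (r n + int n) - ?t (r n)) / real n - of_int N / of_int p) \<le> 1 / real n"
        using p by (simp add: D_def)
    qed
    show "(\<lambda>n. 1 / real n) \<longlonglongrightarrow> 0" by (rule lim_1_over_n)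
  qed
  moreover have "1 + of_int (N - p) / of_int p = (of_int N / of_int p :: real)"
    using p by (simp add: field_simps)
  ultimately have "has_finite_frequency (skew_word b p N) (of_int (N - p) / of_int p)"
    by (simp add: has_finite_frequency_iff[OF starts_skew_word[OF assms p]])
  then show ?thesis
    using p by (auto simp: has_frequency_def)
qed

section \<open>Counting grid points by floors and ceilings\<close>

lemma card_grid:
  fixes p q :: nat and P :: "real \<Rightarrow> bool"
  assumes "0 < p" "0 < q"
  shows "card {z \<in> grid m (1 / (real q / real p)). P z} =
         card {k :: int. P (of_int m + of_int k * (real p / real q))}"
proof -
  let ?g = "\<lambda>k :: int. of_int m + of_int k * (real p / real q)"
  have "{z \<in> grid m (1 / (real q / real p)). P z} = ?g ` {k. P (?g k)}"
    by (auto simp: grid_def)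
  moreover have "inj_on ?g {k. P (?g k)}"
    using assms by (auto simp: inj_on_def)
  ultimately show ?thesis by (simp add: card_image)
qed

lemma grid_point_less_iff:
  fixes p q :: nat
  assumes "0 < p" "0 < q"
  shows "real_of_int n < of_int m + of_int k * (real p / real q) \<longleftrightarrow> (n - m) * int q < k * int p"
    and "of_int m + of_int k * (real p / real q) < real_of_int n \<longleftrightarrow> k * int p < (n - m) * int q"
proof -
  have "real_of_int n < of_int m + of_int k * (real p / real q) \<longleftrightarrow>
        real_of_int ((n - m) * int q) < real_of_int (k * int p)"
    using assms by (simp add: field_simps)
  then show "real_of_int n < of_int m + of_int k * (real p / real q) \<longleftrightarrow> (n - m) * int q < k * int p"
    by (simp only: of_int_less_iff)
  have "of_int m + of_int k * (real p / real q) < real_of_int n \<longleftrightarrow>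
        real_of_int (k * int p) < real_of_int ((n - m) * int q)"
    using assms by (simp add: field_simps)
  then show "of_int m + of_int k * (real p / real q) < real_of_int n \<longleftrightarrow> k * int p < (n - m) * int q"
    by (simp only: of_int_less_iff)
qed

lemma grid_point_le_iff:
  fixes p q :: nat
  assumes "0 < p" "0 < q"
  shows "real_of_int n \<le> of_int m + of_int k * (real p / real q) \<longleftrightarrow> (n - m) * int q \<le> k * int p"
    and "of_int m + of_int k * (real p / real q) \<le> real_of_int n \<longleftrightarrow> k * int p \<le> (n - m) * int q"
  using grid_point_less_iff(2)[OF assms, of m k n] grid_point_less_iff(1)[OF assms, of n m k]
  by (simp_all only: not_less[symmetric])

text \<open>The term \<open>- (- a div p)\<close> is the ceiling of \<open>a / p\<close>. All four
  parts come from the first by negation and by changing the signs of \<open>a\<close> and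
  \<open>k\<close>.\<close>

lemma int_div_less_iff:
  fixes p :: int
  assumes "0 < p"
  shows "a < k * p \<longleftrightarrow> a div p < k" and "k * p < a \<longleftrightarrow> k < - (- a div p)"
    and "k * p \<le> a \<longleftrightarrow> k \<le> a div p" and "a \<le> k * p \<longleftrightarrow> - (- a div p) \<le> k"
proof -
  have *: "a < k * p \<longleftrightarrow> a div p < k" for a k
  proof -
    have bnd: "p * (a div p) \<le> a" "a < p * (a div p) + p"
      using int_div_eq_iff[OF assms, of a "a div p"] by simp_all
    show ?thesis
    proof
      assume "a < k * p"
      with bnd have "p * (a div p) < p * k" unfolding mult.commute[of k p] by linarith
      with assms show "a div p < k" by simp
    next
      assume "a div p < k"
      then have "p * (a div p + 1) \<le> p * k" using assms by (intro mult_left_mono) auto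
      with bnd show "a < k * p" unfolding mult.commute[of k p] distrib_left by linarith
    qed
  qed
  from *[of a k] *[of "- a" "- k"] show "a < k * p \<longleftrightarrow> a div p < k" "k * p < a \<longleftrightarrow> k < - (- a div p)"
    "k * p \<le> a \<longleftrightarrow> k \<le> a div p" "a \<le> k * p \<longleftrightarrow> - (- a div p) \<le> k"
    by auto
qed

lemma skew_start_sum:
  assumes "0 < p"
  shows "skew_start b p (p + q) n = (if (n \<le> 0) = b then n + n * q div p + 1 else n - ((- (n * q)) div p))"
proof -
  have "n * (p + q) div p = n + n * q div p" "(- (n * (p + q))) div p = - n + (- (n * q)) div p"
    using assms div_mult_self1[of p "n * q" n] div_mult_self1[of p "- (n * q)" "- n"]
    by (simp_all add: algebra_simps)
  then show ?thesis by (simp add: skew_start_def)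
qed

text \<open>Half-open intervals contain a difference of floors or of ceilings many grid points,
  according to the endpoint included. The open central cell has floor type on its left and ceiling
  type on its right, just where \<open>skew_start\<close> changes branch. The form
  \<open>n + - m\<close> fits the offset in \<open>similar_iff_increments\<close>.\<close>

lemma int_S_cells:
  fixes p q :: nat
  assumes pq: "0 < p" "0 < q"
  shows "int (S_cells m (real q / real p) n) =
    skew_start True (int p) (int p + int q) (n + - m + 1) - skew_start True (int p) (int p + int q) (n + - m) - 1"
proof -
  define j where "j = n - m"
  let ?F = "\<lambda>a. a div int p" and ?C = "\<lambda>a. - (- a div int p)"
  have p: "0 < int p" using pq by simp
  have ge1: "of_int n + 1 = (of_int (n + 1) :: real)" "of_int m + 1 = (of_int (m + 1) :: real)"
    by simp_all
  have mono: "?F (j * int q) \<le> ?F ((j + 1) * int q)" "?C (j * int q) \<le> ?C ((j + 1) * int q)"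
    using p zdiv_mono1[of "j * int q" "(j + 1) * int q" "int p"]
      zdiv_mono1[of "- ((j + 1) * int q)" "- (j * int q)" "int p"]
    by (simp_all add: distrib_right)
  \<comment> \<open>The central cell has \<open>?C (int q) - 1\<close> zeros, and positivity keeps
    the cardinality from being truncated.\<close>
  have "0 < ?C (int q)"
    using int_div_less_iff(2)[OF p, of 0 "int q"] pq by simp
  consider "j < 0" | "j = 0" | "j > 0" by linarith
  then show ?thesis
  proof cases
    case 1
    then have "S_cells m (real q / real p) n = card {?F (j * int q)<..?F ((j + 1) * int q)}"
      unfolding S_cells_def card_grid[OF pq] ge1 grid_point_less_iff[OF pq] grid_point_le_iff[OF pq]
        int_div_less_iff[OF p]
      by (intro arg_cong[of _ _ card]) (auto simp: j_def algebra_simps)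
    then show ?thesis
      using 1 mono by (simp add: skew_start_sum[OF p] j_def)
  next
    case 2
    then have "S_cells m (real q / real p) n = card {0<..<?C (int q)}"
      unfolding S_cells_def card_grid[OF pq] ge1 grid_point_less_iff[OF pq] grid_point_le_iff[OF pq]
        int_div_less_iff[OF p]
      by (intro arg_cong[of _ _ card]) (auto simp: j_def)
    then show ?thesis
      using 2 \<open>0 < ?C (int q)\<close> by (simp add: skew_start_sum[OF p] j_def)
  next
    case 3
    then have "S_cells m (real q / real p) n = card {?C (j * int q)..<?C ((j + 1) * int q)}"
      unfolding S_cells_def card_grid[OF pq] ge1 grid_point_less_iff[OF pq] grid_point_le_iff[OF pq]
        int_div_less_iff[OF p]
      by (intro arg_cong[of _ _ card]) (auto simp: j_def algebra_simps)
    then show ?thesis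
      using 3 mono by (simp add: skew_start_sum[OF p] j_def)
  qed
qed

lemma int_S'_cells:
  fixes p q :: nat
  assumes pq: "0 < p" "0 < q"
  shows "int (S'_cells m (real q / real p) n) =
    skew_start False (int p) (int p + int q) (n + - m + 1) - skew_start False (int p) (int p + int q) (n + - m) - 1"
proof -
  define j where "j = n - m"
  let ?F = "\<lambda>a. a div int p" and ?C = "\<lambda>a. - (- a div int p)"
  have p: "0 < int p" using pq by simp
  have ge1: "of_int n + 1 = (of_int (n + 1) :: real)" "of_int m + 1 = (of_int (m + 1) :: real)"
    by simp_all
  have mono: "?F (j * int q) \<le> ?F ((j + 1) * int q)" "?C (j * int q) \<le> ?C ((j + 1) * int q)"
    using p zdiv_mono1[of "j * int q" "(j + 1) * int q" "int p"]
      zdiv_mono1[of "- ((j + 1) * int q)" "- (j * int q)" "int p"]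
    by (simp_all add: distrib_right)
  have "0 \<le> ?F (int q)"
    using p by (simp add: pos_imp_zdiv_nonneg_iff)
  consider "j < 0" | "j = 0" | "j > 0" by linarith
  then show ?thesis
  proof cases
    case 1
    then have "S'_cells m (real q / real p) n = card {?C (j * int q)..<?C ((j + 1) * int q)}"
      unfolding S'_cells_def card_grid[OF pq] ge1 grid_point_less_iff[OF pq] grid_point_le_iff[OF pq]
        int_div_less_iff[OF p]
      by (intro arg_cong[of _ _ card]) (auto simp: j_def algebra_simps)
    then show ?thesis
      using 1 mono by (simp add: skew_start_sum[OF p] j_def)
  next
    case 2
    then have "S'_cells m (real q / real p) n = card {0..?F (int q)}"
      unfolding S'_cells_def card_grid[OF pq] ge1 grid_point_less_iff[OF pq] grid_point_le_iff[OF pq]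
        int_div_less_iff[OF p]
      by (intro arg_cong[of _ _ card]) (auto simp: j_def)
    then show ?thesis
      using 2 \<open>0 \<le> ?F (int q)\<close> by (simp add: skew_start_sum[OF p] j_def)
  next
    case 3
    then have "S'_cells m (real q / real p) n = card {?F (j * int q)<..?F ((j + 1) * int q)}"
      unfolding S'_cells_def card_grid[OF pq] ge1 grid_point_less_iff[OF pq] grid_point_le_iff[OF pq]
        int_div_less_iff[OF p]
      by (intro arg_cong[of _ _ card]) (auto simp: j_def algebra_simps)
    then show ?thesis
      using 3 mono by (simp add: skew_start_sum[OF p] j_def)
  qed
qed

lemma skew_params_sum:
  assumes "0 < (p :: nat)" "0 < (q :: nat)"
  shows "skew_params b (int p) (int p + int q) \<longleftrightarrow> coprime q p"
proof -
  have "coprime (int p) (int p + int q) \<longleftrightarrow> coprime q p"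
    by (metis coprime_iff_gcd_eq_1 coprime_int_iff gcd.commute gcd_add2 of_nat_add)
  then show ?thesis
    using assms by (simp add: skew_params_def)
qed

text \<open>Besides \<open>0 < p < N\<close>, where \<open>q = N - p\<close>, only one parameter
  pair remains for each \<open>b\<close>. It is the exceptional sequence that the definitions of the
  types list separately.\<close>

lemma exists_skew_params_iff:
  "(\<exists>p N. skew_params b p N \<and> Q p N) \<longleftrightarrow>
   (\<exists>(p::nat) (q::nat). 0 < p \<and> 0 < q \<and> coprime q p \<and> Q (int p) (int p + int q)) \<or> Q (if b then 0 else 1) 1"
    (is "?L \<longleftrightarrow> ?R")
proof
  assume ?L
  then obtain p N where pN: "skew_params b p N" "Q p N" by blast
  show ?R
  proof (cases "0 < p \<and> p < N")
    case True
    define p' q' where "p' = nat p" "q' = nat (N - p)"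
    then have "0 < p'" "0 < q'" "p = int p'" "N = int p' + int q'" using True by auto
    with pN skew_params_sum[of p' q' b] show ?thesis by auto
  next
    case False
    then have "p = 0 \<or> p = N" "N > 0" "coprime p N" "p = (if b then 0 else N)"
      using pN(1) by (auto simp: skew_params_def split: if_splits)
    then have "N = 1" "p = (if b then 0 else 1)" by auto
    with pN(2) show ?thesis by simp
  qed
next
  assume ?R
  moreover have "skew_params b (if b then 0 else 1) 1" by (simp add: skew_params_def)
  ultimately show ?L using skew_params_sum by blast
qed

lemma type_S_iff: "type_S x \<longleftrightarrow> (\<exists>p N. skew_params True p N \<and> similar (skew_word True p N) x)"
proof -
  have "has_cell_series x (S_cells m (real q / real p)) \<longleftrightarrow> similar (skew_word True (int p) (int p + int q)) x"
    if "0 < p" "0 < q" "coprime q p" for p q :: nat and m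
    using that by (intro similar_iff_increments[OF starts_skew_word int_S_cells]) (auto simp: skew_params_sum)
  then show ?thesis
    unfolding type_S_def exists_skew_params_iff single_one_iff_similar if_True if_False by (smt (verit))
qed

lemma type_S'_iff: "type_S' x \<longleftrightarrow> (\<exists>p N. skew_params False p N \<and> similar (skew_word False p N) x)"
proof -
  have "has_cell_series x (S'_cells m (real q / real p)) \<longleftrightarrow> similar (skew_word False (int p) (int p + int q)) x"
    if "0 < p" "0 < q" "coprime q p" for p q :: nat and m
    using that by (intro similar_iff_increments[OF starts_skew_word int_S'_cells]) (auto simp: skew_params_sum)
  then show ?thesis
    unfolding type_S'_def exists_skew_params_iff single_zero_iff_similar if_True if_False by (smt (verit))
qed


subsection \<open>Classification of skew Sturmian sequences\<close>

text \<open>A predicate that never both rises and falls is monotone; not being constant, it has a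
  threshold \<open>J\<close>, and \<open>b\<close> tells the direction.\<close>

lemma monotone_int_predicate:
  fixes e :: "int \<Rightarrow> bool"
  assumes "e u" "\<not> e v" and steps: "\<And>i j. \<lbrakk>\<not> e i; e (i + 1); e j; \<not> e (j + 1)\<rbrakk> \<Longrightarrow> False"
  obtains J b where "\<And>j. e j \<longleftrightarrow> (j \<le> J) = b"
proof (cases "\<exists>J. \<not> e J \<and> e (J + 1)")
  case True
  then obtain J where J: "\<not> e J" "e (J + 1)" by blast
  with steps have up: "e j \<Longrightarrow> e (j + 1)" for j by blast
  have "e k" if "e j" "j \<le> k" for j k
    using that(2,1) by (induction k rule: int_ge_induct) (use up in auto)
  with J have "e j \<longleftrightarrow> (j \<le> J) = False" for j
    by (meson not_le zle_add1_eq_le add1_zle_eq)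
  then show ?thesis by (rule that)
next
  case False
  then have down: "e (j + 1) \<Longrightarrow> e j" for j by blast
  have anti: "e j" if "e k" "j \<le> k" for j k
    using that(2,1) by (induction k rule: int_ge_induct) (use down in auto)
  have "\<exists>J. e J \<and> \<not> e (J + 1)"
  proof (rule ccontr)
    assume "\<not> ?thesis"
    then have up: "e j \<Longrightarrow> e (j + 1)" for j by blast
    have "u \<le> v \<Longrightarrow> e v"
      by (induction v rule: int_ge_induct) (use up \<open>e u\<close> in auto)
    with anti[OF \<open>e u\<close>] \<open>\<not> e v\<close> show False by (meson linear)
  qed
  then obtain J where J: "e J" "\<not> e (J + 1)" by blast
  with anti have "e j \<longleftrightarrow> (j \<le> J) = True" for j
    by (meson not_le add1_zle_eq)
  then show ?thesis by (rule that)
qed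

text \<open>By balance, \<open>K\<close> consecutive blocks of \<open>m\<close> cells have total
  length \<open>K * D\<close> up to an error of \<open>K\<close>. Dividing by \<open>K\<close> and
  letting it grow replaces the average block length by \<open>m * \<rho>\<close>.\<close>

lemma balanced_deviation:
  fixes t :: "int \<Rightarrow> int"
  assumes bal: "\<And>r s. \<bar>(t (r + int m) - t r) - (t (s + int m) - t s)\<bar> \<le> 1"
    and lim: "(\<lambda>n. real_of_int (t (int n) - t 0) / real n) \<longlonglongrightarrow> \<rho>" and "m > 0"
  shows "\<bar>real m * \<rho> - of_int (t (r + int m) - t r)\<bar> \<le> 1"
proof -
  define D where "D = t (r + int m) - t r"
  have sum: "\<bar>t (int (K * m)) - t 0 - int K * D\<bar> \<le> int K" for K
  proof (induction K)
    case (Suc K)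
    have "int (Suc K * m) = int (K * m) + int m" by simp
    with bal[of "int (K * m)" r] have "\<bar>t (int (Suc K * m)) - t (int (K * m)) - D\<bar> \<le> 1"
      by (simp only: D_def)
    with Suc show ?case by (simp add: distrib_right)
  qed simp
  have "(\<lambda>K. real_of_int (t (int (K * m)) - t 0) / real (K * m)) \<longlonglongrightarrow> \<rho>"
    using LIMSEQ_subseq_LIMSEQ[OF lim, of "\<lambda>K. K * m"] \<open>m > 0\<close>
    by (simp add: o_def strict_mono_def)
  then have "(\<lambda>K. \<bar>real m * (real_of_int (t (int (K * m)) - t 0) / real (K * m)) - of_int D\<bar>)
      \<longlonglongrightarrow> \<bar>real m * \<rho> - of_int D\<bar>"
    by (intro tendsto_intros)
  moreover have "\<bar>real m * (real_of_int (t (int (K * m)) - t 0) / real (K * m)) - of_int D\<bar> \<le> 1"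
    if "K \<ge> 1" for K
  proof -
    have "real m * (real_of_int (t (int (K * m)) - t 0) / real (K * m)) - of_int D =
          of_int (t (int (K * m)) - t 0 - int K * D) / real K"
      using that \<open>m > 0\<close> by (simp add: field_simps)
    moreover have "\<bar>real_of_int (t (int (K * m)) - t 0 - int K * D)\<bar> \<le> real K"
      using sum[of K] by linarith
    ultimately show ?thesis
      using that by (simp only: abs_divide) (simp add: divide_le_eq)
  qed
  ultimately show ?thesis
    unfolding D_def[symmetric] by (intro Lim_bounded[of _ _ 1]) auto
qed

text \<open>
  With \<open>t\<close> the starts of the cells and \<open>N/p\<close> the mean cell length, \<open>d i = p * t i - i * N\<close>
  oscillates by at most \<open>p\<close>, and by exactly \<open>p\<close> since \<open>t i\<close> would otherwise be determined by \<open>d i\<close>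
  modulo \<open>p\<close>, making the sequence periodic. Only the two extreme values are congruent modulo \<open>p\<close>, so
  there is a binary choice for \<open>i\<close> in a single residue class; balance forces it to be monotone.
\<close>

lemma sturmian_similar_skew_word:
  assumes "sturmian x" and nonper: "\<not> periodic_seq x" and "\<alpha> \<in> \<rat>" "has_finite_frequency x \<alpha>"
  obtains b p N where "skew_params b p N" "similar (skew_word b p N) x"
proof -
  obtain t where t: "starts x t"
    using assms(4) by (auto simp: has_finite_frequency_def has_cell_series_iff)
  then have mono: "t n < t (n + 1)" for n
    by (simp add: starts_def)
  have bal: "\<bar>(t (r + int m) - t r) - (t (s + int m) - t s)\<bar> \<le> 1" if "m > 0" for m r s
    using assms(1) that by (simp add: sturmian_iff[OF t])
  define \<rho> where "\<rho> = 1 + \<alpha>"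
  have lim: "(\<lambda>n. real_of_int (t (int n) - t 0) / real n) \<longlonglongrightarrow> \<rho>"
    using assms(4) unfolding has_finite_frequency_iff[OF t] \<rho>_def
    by (auto dest: spec[of _ "\<lambda>_. 0"])
  obtain N p where pN: "\<rho> = of_int N / of_int p" "p > 0" "coprime N p"
    using assms(3) by (metis Rats_1 Rats_add Rats_cases' \<rho>_def)
  \<comment> \<open>Every cell has length at least 1, hence so has the mean, which yields
    \<open>p \<le> N\<close>.\<close>
  have "int n \<le> t (int n) - t 0" for n
  proof (induction n)
    case (Suc n)
    then show ?case using mono[of "int n"] by (simp add: add.commute)
  qed simp
  then have "1 \<le> real_of_int (t (int n) - t 0) / real n" if "n \<ge> 1" for n
    using that by (simp add: le_divide_eq) (metis of_int_diff of_int_le_iff of_int_of_nat_eq)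
  then have "1 \<le> \<rho>"
    by (intro LIMSEQ_le_const[OF lim]) blast
  then have "p \<le> N"
    using pN by (simp add: le_divide_eq)

  define d where "d i = p * t i - i * N" for i
  have dist': "\<bar>d i - d j\<bar> \<le> p" if "j < i" for i j
  proof -
    define m where "m = nat (i - j)"
    have m: "m > 0" "i = j + int m" using that by (auto simp: m_def)
    have "\<bar>real m * \<rho> - of_int (t i - t j)\<bar> \<le> 1"
      using balanced_deviation[OF bal lim, of m j] m by simp
    then have "of_int p * \<bar>real m * \<rho> - of_int (t i - t j)\<bar> \<le> of_int p * 1"
      using pN(2) by (intro mult_left_mono) auto
    also have "of_int p * \<bar>real m * \<rho> - of_int (t i - t j)\<bar> = \<bar>of_int p * (real m * \<rho> - of_int (t i - t j))\<bar>"
      using pN(2) by (simp add: abs_mult)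
    also have "of_int p * (real m * \<rho> - of_int (t i - t j)) = real_of_int (d j - d i)"
      using pN(2) by (simp add: pN(1) d_def m(2) field_simps)
    finally show ?thesis by linarith
  qed
  have dist: "\<bar>d i - d j\<bar> \<le> p" for i j
    using dist'[of i j] dist'[of j i] pN(2) by (cases i j rule: linorder_cases) auto
  \<comment> \<open>Adding \<open>p\<close> makes the values nonnegative by \<open>dist\<close>, so
    that a minimum exists among natural numbers.\<close>
  obtain i1 where "\<forall>i. nat (d i1 - d 0 + p) \<le> nat (d i - d 0 + p)"
    using ex_has_least_nat[of "\<lambda>_. True" 0 "\<lambda>i. nat (d i - d 0 + p)"] by auto
  then have min: "d i1 \<le> d i" for i
    using dist[of i1 0] dist[of i 0] by (smt (verit) nat_le_eq_zle)
  define a where "a = d i1"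
  have range_d: "a \<le> d i" "d i \<le> a + p" for i
    using min[of i] dist[of i i1] by (auto simp: a_def)
  have dvd_d: "p dvd d i - d j \<longleftrightarrow> p dvd i - j" for i j
  proof -
    have "d i - d j = p * (t i - t j) - (i - j) * N"
      by (simp add: d_def algebra_simps)
    then have "p dvd d i - d j \<longleftrightarrow> p dvd (i - j) * N"
      by (simp add: dvd_diff_right_iff)
    also have "\<dots> \<longleftrightarrow> p dvd i - j"
      using pN(3) by (simp add: coprime_dvd_mult_left_iff coprime_commute)
    finally show ?thesis .
  qed
  have extreme: "d i = a \<or> d i = a + p" if "p dvd i - i1" for i
  proof -
    have "p dvd d i - a" using that dvd_d by (simp add: a_def)
    then obtain c where c: "d i - a = p * c" by blast
    with range_d[of i] have "p * 0 \<le> p * c" "p * c \<le> p * 1" by auto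
    then have "0 \<le> c" "c \<le> 1" using pN(2) by (simp_all only: mult_le_cancel_left_pos)
    then have "c = 0 \<or> c = 1" by linarith
    with c show ?thesis by auto
  qed

  \<comment> \<open>Otherwise the values of \<open>d\<close> spread over less than \<open>p\<close>.
    As they are determined modulo \<open>p\<close> by the index, \<open>d\<close> has period
    \<open>p\<close>, and \<open>x\<close> has period \<open>N\<close>.\<close>
  have "\<exists>i. d i = a + p"
  proof (rule ccontr)
    assume "\<nexists>i. d i = a + p"
    with range_d have lt: "d i < a + p" for i by (metis order_le_less)
    have "d (i + p) = d i" for i
    proof (rule ccontr)
      assume "d (i + p) \<noteq> d i"
      moreover have "p dvd d (i + p) - d i" by (simp add: dvd_d)
      ultimately have "p \<le> \<bar>d (i + p) - d i\<bar>"
        using dvd_imp_le_int[of "d (i + p) - d i" p] pN(2) by simp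
      with lt[of i] lt[of "i + p"] range_d(1)[of i] range_d(1)[of "i + p"] show False by linarith
    qed
    then have "p * t (i + p) = p * (t i + N)" for i
      by (simp add: d_def algebra_simps)
    then have tp: "t (i + p) = t i + N" for i
      using pN(2) by simp
    have "x (i + N) \<longleftrightarrow> x i" for i
    proof -
      have "i + N \<in> range t \<longleftrightarrow> i \<in> range t"
      proof
        assume "i + N \<in> range t"
        then obtain n where "i + N = t n" by blast
        with tp[of "n - p"] have "i = t (n - p)" by simp
        then show "i \<in> range t" by blast
      next
        assume "i \<in> range t"
        then obtain n where "i = t n" by blast
        with tp[of n] have "i + N = t (n + p)" by simp
        then show "i + N \<in> range t" by blast
      qed
      then show ?thesis using t by (simp add: starts_def)
    qed
    then have "shift N x = x" by (simp add: fun_eq_iff)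
    with nonper \<open>p \<le> N\<close> pN(2) show False
      by (auto simp: periodic_seq_def)
  qed
  then obtain i2 where i2: "d i2 = a + p" by blast

  define e where "e j \<longleftrightarrow> d (i1 + j * p) = a + p" for j
  have e_not: "d (i1 + j * p) = a" if "\<not> e j" for j
    using extreme[of "i1 + j * p"] that by (simp add: e_def)
  have "\<not> e 0" using pN(2) by (simp add: e_def a_def)
  have "p dvd d i2 - d i1"
    by (simp add: i2 a_def)
  then obtain j2 where "i2 - i1 = p * j2"
    unfolding dvd_d by blast
  then have "i2 = i1 + j2 * p" by (simp add: algebra_simps)
  with i2 have "e j2" by (simp add: e_def)
  have t_step: "p * (t (i1 + (j + 1) * p) - t (i1 + j * p)) = d (i1 + (j + 1) * p) - d (i1 + j * p) + p * N" for j
    by (simp add: d_def algebra_simps)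
  \<comment> \<open>A rise gives \<open>p\<close> cells of total length \<open>N + 1\<close>, a fall
    \<open>p\<close> cells of total length \<open>N - 1\<close>; these differ by 2.\<close>
  have no_both: False if "\<not> e i" "e (i + 1)" "e j" "\<not> e (j + 1)" for i j
  proof -
    have "p * (t (i1 + (i + 1) * p) - t (i1 + i * p)) = p * (N + 1)"
      using that e_not[of i] unfolding t_step by (simp add: e_def algebra_simps)
    moreover have "p * (t (i1 + (j + 1) * p) - t (i1 + j * p)) = p * (N - 1)"
      using that e_not[of "j + 1"] unfolding t_step by (simp add: e_def algebra_simps)
    ultimately have "t (i1 + (i + 1) * p) - t (i1 + i * p) = N + 1" "t (i1 + (j + 1) * p) - t (i1 + j * p) = N - 1"
      using pN(2) by simp_all
    moreover have "i1 + (i + 1) * p = i1 + i * p + int (nat p)" for i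
      using pN(2) by (simp add: algebra_simps)
    ultimately show False
      using bal[of "nat p" "i1 + i * p" "i1 + j * p"] pN(2) by simp
  qed
  obtain J b where J: "\<And>j. e j \<longleftrightarrow> (j \<le> J) = b"
    using monotone_int_predicate[of e j2 0] \<open>e j2\<close> \<open>\<not> e 0\<close> no_both by metis

  \<comment> \<open>The threshold becomes index 0. Subtracting \<open>of_bool b\<close> matches
    \<open>skew_start b p N 0\<close>, which is 1 if \<open>b\<close> holds and 0 otherwise.\<close>
  define I where "I = i1 + J * p"
  define \<tau> where "\<tau> = t I - of_bool b"
  have "e J \<longleftrightarrow> b" by (simp add: J)
  then have dI: "d I = a + p * of_bool b"
    using e_not[of J] by (auto simp: e_def I_def)
  have start: "t (n + I) - \<tau> = skew_start b p N n" for n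
  proof -
    define \<delta> where "\<delta> = d (n + I) - a"
    have \<delta>: "p * (t (n + I) - \<tau>) = n * N + \<delta>"
      using dI by (simp add: \<delta>_def d_def \<tau>_def algebra_simps)
    have "0 \<le> \<delta>" "\<delta> \<le> p" using range_d[of "n + I"] by (auto simp: \<delta>_def)
    moreover have "(\<delta> = p) = ((n \<le> 0) = b)" if "\<delta> = 0 \<or> \<delta> = p"
    proof -
      have "p dvd d (n + I) - d i1" using that by (auto simp: \<delta>_def a_def)
      then have "p dvd n + I - i1" unfolding dvd_d .
      then have "p dvd n" by (simp add: I_def add_diff_eq[symmetric])
      then obtain j where j: "n = p * j" by blast
      have "\<delta> = p \<longleftrightarrow> e (J + j)"
        by (auto simp: \<delta>_def e_def I_def j algebra_simps)
      also have "\<dots> \<longleftrightarrow> (n \<le> 0) = b"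
        using pN(2) by (simp add: J j mult_le_0_iff)
      finally show ?thesis .
    qed
    \<comment> \<open>For \<open>\<delta>\<close> strictly between 0 and \<open>p\<close> both
      half-open intervals fit; only the endpoints need the threshold.\<close>
    ultimately have "if (n \<le> 0) = b then 0 < \<delta> \<and> \<delta> \<le> p else 0 \<le> \<delta> \<and> \<delta> < p"
      using pN(2) by (smt (verit))
    then have "skew_start b p N n = t (n + I) - \<tau>"
      unfolding skew_start_eq_iff[OF pN(2)] \<delta> by auto
    then show ?thesis ..
  qed
  have "starts (shift \<tau> x) (skew_start b p N)"
    using starts_shift[OF starts_reindex[OF t, of I], of \<tau>] by (simp add: start)
  then have step: "skew_start b p N 0 < skew_start b p N (0 + 1)"
    and rng: "\<And>i. shift \<tau> x i \<longleftrightarrow> i \<in> range (skew_start b p N)"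
    unfolding starts_def by blast+
  \<comment> \<open>With \<open>p = N\<close> and \<open>b\<close> true, the starts number 0 and 1
    would both be 1.\<close>
  have "p \<noteq> N" if b
    using step that pN(2) by (auto simp: skew_start_def zdiv_zminus1_eq_if)
  then have "skew_params b p N"
    using pN \<open>p \<le> N\<close> by (auto simp: skew_params_def coprime_commute)
  moreover have "shift \<tau> x = skew_word b p N"
    using rng range_skew_start[OF pN(2) \<open>p \<le> N\<close>] by (auto simp: fun_eq_iff)
  then have "similar (skew_word b p N) x"
    by (metis similar_def similar_sym)
  ultimately show ?thesis by (rule that)
qed

lemma skew_sturmian_similar_skew_word:
  assumes "skew_sturmian x"
  obtains b p N where "skew_params b p N" "similar (skew_word b p N) x"
proof (cases "single_one x")
  case True
  have "skew_params True 0 1" by (simp add: skew_params_def)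
  with True that show ?thesis unfolding single_one_iff_similar by blast
next
  case False
  with assms have "sturmian x" "\<not> periodic_seq x" "\<exists>\<alpha>\<in>\<rat>. has_finite_frequency x \<alpha>"
    by (auto simp: skew_sturmian_def)
  with that sturmian_similar_skew_word show ?thesis by metis
qed

lemma skew_sturmian_not_periodic:
  assumes "skew_sturmian x"
  shows "\<not> periodic_seq x"
proof (cases "single_one x")
  case True
  then obtain k where k: "\<And>i. x i \<longleftrightarrow> i = k" by (auto simp: single_one_def)
  show ?thesis
  proof
    assume "periodic_seq x"
    then obtain N where "N > 0" "shift N x = x" by (auto simp: periodic_seq_def)
    then have "x (k + N) = x k" by (metis shift_apply)
    with k \<open>N > 0\<close> show False by simp
  qed
qed (use assms in \<open>auto simp: skew_sturmian_def\<close>)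

section \<open>Conjugacy in terms of the parameters\<close>

lemma type_of_similar:
  assumes "skew_params b p N" "similar (skew_word b p N) x"
  shows "if b then type_S x else type_S' x"
proof (cases b)
  case True
  with assms show ?thesis by (simp add: type_S_iff) blast
next
  case False
  with assms show ?thesis by (simp add: type_S'_iff) blast
qed

lemma generated_subshift_similar: "similar x y \<Longrightarrow> generated_subshift x = generated_subshift y"
  by (auto simp: similar_def generated_subshift_shift)

lemma inverse_ereal_divide:
  fixes r s :: real
  assumes "0 \<le> r" "0 \<le> s" "r \<noteq> 0 \<or> s \<noteq> 0"
  shows "inverse (ereal r / ereal s) = ereal s / ereal r"
  using assms by (auto simp: zero_ereal_def[symmetric])

lemma skew_params_frequency_inverse:
  assumes "skew_params b p N"
  shows "inverse (ereal (of_int (N - p)) / ereal (of_int p)) = ereal (of_int p) / ereal (of_int (N - p))"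
  using assms by (intro inverse_ereal_divide) (auto simp: skew_params_def)

lemma skew_params_coprime:
  assumes "skew_params b p N"
  shows "coprime N p" "coprime N (N - p)"
  using assms skew_params_compl[OF assms] by (auto simp: skew_params_def coprime_commute)

lemma conjugate_of_inverse_frequencies:
  assumes x: "skew_params b p N" "similar (skew_word b p N) x"
    and y: "skew_params (\<not> b) q M" "similar (skew_word (\<not> b) q M) y"
    and "inverse_frequencies x y"
  shows "conjugate (generated_subshift x) (generated_subshift y)"
proof -
  have pos: "0 \<le> p" "p \<le> N" "0 < N" "0 \<le> q" "q \<le> M" "0 < M"
    using x(1) y(1) by (auto simp: skew_params_def)
  obtain a where "has_frequency x a" "has_frequency y (inverse a)"
    using assms(5) by (auto simp: inverse_frequencies_def)
  then have "a = ereal (of_int (N - p)) / ereal (of_int p)" "inverse a = ereal (of_int (M - q)) / ereal (of_int q)"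
    using similar_has_frequency[OF x(2) has_frequency_skew_word[OF x(1)]]
      similar_has_frequency[OF y(2) has_frequency_skew_word[OF y(1)]] has_frequency_unique by blast+
  then have eq: "ereal (of_int p) / ereal (of_int (N - p)) = ereal (of_int (M - q)) / ereal (of_int q)"
    using skew_params_frequency_inverse[OF x(1)] by simp
  \<comment> \<open>This is the cross-multiplied equality of frequencies. An infinite value on
    either side has to be treated apart.\<close>
  have "M * (N - p) = q * N"
  proof (cases "p = N \<or> q = 0")
    case True
    with eq pos have "p = N \<and> q = 0" by (auto split: if_splits)
    then show ?thesis by simp
  next
    case False
    then have "real_of_int p / of_int (N - p) = of_int (M - q) / of_int q"
      using eq by simp
    then have "real_of_int p * of_int q = of_int (M - q) * of_int (N - p)"
      using False by (simp add: frac_eq_eq del: of_int_diff)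
    then have "p * q = (M - q) * (N - p)"
      by (metis of_int_eq_iff of_int_mult)
    then show ?thesis by (simp add: algebra_simps)
  qed
  moreover from this have "N dvd M * (N - p)" "M dvd q * N"
    by (metis dvd_triv_left dvd_triv_right)+
  \<comment> \<open>Both fractions are in lowest terms, so the denominators coincide.\<close>
  then have "N dvd M" "M dvd N"
    using skew_params_coprime[OF x(1)] skew_params_coprime[OF y(1)]
    by (simp_all add: coprime_dvd_mult_left_iff coprime_dvd_mult_right_iff)
  then have "M = N" using pos by (simp add: zdvd_antisym_nonneg)
  ultimately have "q = N - p" using pos by simp
  with \<open>M = N\<close> have "skew_word (\<not> b) q M = (\<lambda>i. \<not> skew_word b p N i)"
    using skew_word_compl[OF \<open>0 < N\<close>] by auto
  with generated_subshift_similar[OF x(2)] generated_subshift_similar[OF y(2)] conjugate_compl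
  show ?thesis by metis
qed

lemma similar_skew_word_phase:
  assumes "skew_params b p N" "similar (skew_word b p N) x"
  obtains u k where "asymptotic_phase x u N k" "N dvd p * k - (if b then 1 else - 1)"
proof -
  obtain s where "shift s (skew_word b p N) = x"
    using assms(2) by (auto simp: similar_def)
  with asymptotic_phase_skew_word[OF assms(1)] asymptotic_phase_shift that show ?thesis
    by metis
qed

text \<open>Up to the sign given by the type, the phase is the inverse of the number of 1's modulo
  the period. Equal phases thus force these numbers to agree up to sign.\<close>

lemma conjugate_skew_params:
  assumes x: "skew_params b p N" "similar (skew_word b p N) x" "\<not> periodic_seq x"
    and y: "skew_params c q M" "similar (skew_word c q M) y"
    and "conjugate (generated_subshift x) (generated_subshift y)"
  shows "M = N" "q = (if b = c then p else N - p)"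
proof -
  obtain u k where u: "asymptotic_phase x u N k" and k: "N dvd p * k - (if b then 1 else - 1)"
    using similar_skew_word_phase[OF x(1,2)] by blast
  obtain v l where v: "asymptotic_phase y v M l" and l: "M dvd q * l - (if c then 1 else - 1)"
    using similar_skew_word_phase[OF y] by blast
  from conjugate_asymptotic_phase[OF u x(3) v assms(6)] have "N = M" and kl: "N dvd k - l"
    by auto
  then show "M = N" by simp
  define s r :: int where "s = (if b then 1 else - 1)" and "r = (if c then 1 else - 1)"
  \<comment> \<open>This combination eliminates both phases: what remains is
    \<open>p * r - q * s\<close>.\<close>
  have "N dvd q * (p * k - s) - p * (q * l - r) - p * q * (k - l)"
    using k l kl \<open>N = M\<close> by (intro dvd_diff[OF dvd_diff[OF dvd_mult dvd_mult] dvd_mult]) (simp_all add: s_def r_def)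
  then have dvd: "N dvd p * r - q * s"
    by (simp add: algebra_simps)
  have pos: "0 \<le> p" "p \<le> N" "0 < N" "if b then p < N else 0 < p" "0 \<le> q" "q \<le> N" "if c then q < N else 0 < q"
    using x(1) y(1) \<open>N = M\<close> by (auto simp: skew_params_def)
  show "q = (if b = c then p else N - p)"
  proof (cases "b = c")
    case True
    then have "N dvd p - q"
      using dvd dvd_minus_iff[of N "p - q"] by (auto simp: s_def r_def split: if_splits)
    moreover have "\<bar>p - q\<bar> < N" using pos True by (auto split: if_splits)
    ultimately have "p - q = 0" using dvd_imp_le_int[of "p - q" N] pos by linarith
    with True show ?thesis by simp
  next
    case False
    then have "N dvd p + q"
      using dvd dvd_minus_iff[of N "p + q"] by (auto simp: s_def r_def split: if_splits)
    then obtain j where j: "p + q = N * j" by blast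
    \<comment> \<open>For opposite types exactly one of \<open>p < N\<close> and
      \<open>q < N\<close> is guaranteed and the other number is positive, so \<open>p + q\<close>
      lies strictly between 0 and \<open>2 * N\<close>.\<close>
    have "N * 0 < N * j" "N * j < N * 2" using pos False by (auto simp: j[symmetric] split: if_splits)
    then have "j = 1" using pos by (simp only: mult_less_cancel_left_pos)
    with j False show ?thesis by simp
  qed
qed

theorem corollary3p6:
  fixes x y :: biseq
  assumes "skew_sturmian x" and "skew_sturmian y" and "\<not> similar x y"
  shows "conjugate (generated_subshift x) (generated_subshift y) \<longleftrightarrow>
         inverse_frequencies x y \<and> opposite_type x y"
proof
  assume conj: "conjugate (generated_subshift x) (generated_subshift y)"
  obtain b p N where x: "skew_params b p N" "similar (skew_word b p N) x"
    using skew_sturmian_similar_skew_word[OF assms(1)] .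
  obtain c q M where y: "skew_params c q M" "similar (skew_word c q M) y"
    using skew_sturmian_similar_skew_word[OF assms(2)] .
  note MN = conjugate_skew_params[OF x skew_sturmian_not_periodic[OF assms(1)] y conj]
  \<comment> \<open>For equal types the parameters agree, so \<open>x\<close> and \<open>y\<close>
    are shifts of the same word.\<close>
  have "b \<noteq> c"
  proof
    assume "b = c"
    with MN y(2) have "similar (skew_word b p N) y" by simp
    from similar_trans[OF similar_sym[OF x(2)] this] assms(3) show False by simp
  qed
  with MN have "M = N" "q = N - p" "c = (\<not> b)" by auto
  have "has_frequency x (ereal (of_int (N - p)) / ereal (of_int p))"
    using similar_has_frequency[OF x(2) has_frequency_skew_word[OF x(1)]] .
  moreover have "has_frequency y (ereal (of_int (N - (N - p))) / ereal (of_int (N - p)))"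
    using similar_has_frequency[OF y(2) has_frequency_skew_word[OF y(1)]]
    unfolding \<open>M = N\<close> \<open>q = N - p\<close> .
  then have "has_frequency y (inverse (ereal (of_int (N - p)) / ereal (of_int p)))"
    unfolding skew_params_frequency_inverse[OF x(1)] by (simp only: diff_diff_eq2 add_diff_cancel_left')
  ultimately have "inverse_frequencies x y"
    unfolding inverse_frequencies_def by blast
  moreover have "opposite_type x y"
    using type_of_similar[OF x] type_of_similar[OF y] \<open>c = (\<not> b)\<close>
    by (simp add: opposite_type_def split: if_splits)
  ultimately show "inverse_frequencies x y \<and> opposite_type x y" ..
next
  assume *: "inverse_frequencies x y \<and> opposite_type x y"
  have "\<exists>b p N q M. skew_params b p N \<and> similar (skew_word b p N) x \<and>
    skew_params (\<not> b) q M \<and> similar (skew_word (\<not> b) q M) y"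
  proof -
    consider "type_S x" "type_S' y" | "type_S' x" "type_S y"
      using * by (auto simp: opposite_type_def)
    then show ?thesis
      unfolding type_S_iff type_S'_iff
    proof cases
      case 1
      then show ?thesis by (intro exI[of _ True]) simp
    next
      case 2
      then show ?thesis by (intro exI[of _ False]) simp
    qed
  qed
  then show "conjugate (generated_subshift x) (generated_subshift y)"
    using conjugate_of_inverse_frequencies * by blast
qed


end
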